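(* Suppose the weights $w(y)$, $\frac{p_{\pi^*}(e,x)}{p_{\pi^b}(e,x)}$ and $\rho(a,x)$ are known exactly, and suppose that $Y\perp\!\!\!\perp A\mid (X,E)$, where $E$ is an embedding of the action. Let $$\hat\theta_{\mathrm{IPW}}=\frac1n\sum_{i=1}^n\rho(a_i,x_i)\,y_i,\qquad \hat\theta_{\mathrm{MIPS}}=\frac1n\sum_{i=1}^n\frac{p_{\pi^*}(e_i,x_i)}{p_{\pi^b}(e_i,x_i)}\,y_i,\qquad \hat\theta_{\mathrm{MR}}=\frac1n\sum_{i=1}^n w(y_i)\,y_i .$$ Then $$\mathbb E_{\pi^b}[\hat\theta_{\mathrm{MR}}]=\mathbb E_{\pi^b}[\hat\theta_{\mathrm{MIPS}}]=\mathbb E_{\pi^*}[Y]\quad\text{and}\quad \mathrm{Var}_{\pi^b}[\hat\theta_{\mathrm{MR}}]\le\mathrm{Var}_{\pi^b}[\hat\theta_{\mathrm{MIPS}}]\le\mathrm{Var}_{\pi^b}[\hat\theta_{\mathrm{IPW}}].$$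
   Context: Contextual bandit setting with action embeddings. $X\in\mathcal X$ is a context, $A\in\mathcal A$ an action, $E$ an action embedding, $Y\in\mathcal Y\subseteq\mathbb R$ a scalar outcome. Contexts have density $p(x)$, and the conditional laws $p(e\mid x,a)$ and of $Y$ given $(X,A,E)$ do not depend on the policy. The assumption $Y\perp\!\!\!\perp A\mid (X,E)$ corresponds to the Bayesian network $(X,A)\to(X,E)\to Y$; i.e. under a policy $\pi(a\mid x)$ the joint density is $p_\pi(x,a,e,y)=p(x)\,\pi(a\mid x)\,p(e\mid x,a)\,p(y\mid x,e)$ (densities with respect to fixed reference measures). $p_\pi(e,x)$ and $p_\pi(y)$ denote the corresponding marginal densities of $(E,X)$ and $Y$; $\mathbb E_\pi$, $\mathrm{Var}_\pi$ denote expectation and variance under $p_\pi$. There is a behaviour policy $\pi^b$ and a target policy $\pi^*$; the data $(x_i,a_i,e_i,y_i)_{i=1}^n$ are i.i.d. from $p_{\pi^b}$, and expectations/variances of estimators are over this data. Define $\rho(a,x)=\pi^*(a\mid x)/\pi^b(a\mid x)$ and $w(y)=p_{\pi^*}(y)/p_{\pi^b}(y)$. Standing assumption (support): for all $x\in\mathcal X,a\in\mathcal A$, $\pi^*(a\mid x)>0\implies\pi^b(a\mid x)>0$. All expectations and variances appearing are implicitly assumed to exist and be finite. *)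

theory Defs
  imports "HOL-Probability.Probability"
begin

text \<open>
  \<open>cond_density C D k\<close>: the function \<open>k c d\<close> is a conditional density \<open>k(d | c)\<close> with respect to
  the reference measure \<open>D\<close>.  Of the measure space \<open>C\<close> of conditioning values only the
  sigma-algebra matters here.
\<close>

definition cond_density :: "'c measure \<Rightarrow> 'd measure \<Rightarrow> ('c \<Rightarrow> 'd \<Rightarrow> real) \<Rightarrow> bool" where
  "cond_density C D k \<longleftrightarrow>
     (\<lambda>(c, d). k c d) \<in> borel_measurable (C \<Otimes>\<^sub>M D) \<and>
     (\<forall>c\<in>space C. \<forall>d\<in>space D. 0 \<le> k c d) \<and>
     (\<forall>c\<in>space C. (\<integral>\<^sup>+ d. ennreal (k c d) \<partial>D) = 1)"

text \<open>
  The policy-independent part of a contextual bandit with action embeddings: the reference measures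
  for contexts, actions, embeddings and outcomes, and the densities \<open>p(x)\<close>, \<open>p(e | x, a)\<close> and
  \<open>p(y | x, a, e)\<close>.  The spaces of contexts, actions, embeddings and outcomes are the \<open>space\<close>s of
  the reference measures.
\<close>

record ('x, 'a, 'e) bandit =
  ctx_ref :: "'x measure"
  act_ref :: "'a measure"
  emb_ref :: "'e measure"
  out_ref :: "real measure"
  p_ctx :: "'x \<Rightarrow> real"
  p_emb :: "'x \<times> 'a \<Rightarrow> 'e \<Rightarrow> real"
  p_out :: "'x \<times> 'a \<times> 'e \<Rightarrow> real \<Rightarrow> real"

text \<open>
  The condition on \<open>out_ref\<close> says that the outcome space is an arbitrary subset of the reals with
  its Borel sigma-algebra; the reference measure itself need not be Lebesgue measure.
\<close>

definition bandit_model :: "('x, 'a, 'e) bandit \<Rightarrow> bool" where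
  "bandit_model B \<longleftrightarrow>
     sigma_finite_measure (ctx_ref B) \<and> sigma_finite_measure (act_ref B) \<and>
     sigma_finite_measure (emb_ref B) \<and> sigma_finite_measure (out_ref B) \<and>
     sets (out_ref B) = sets (restrict_space borel (space (out_ref B))) \<and>
     p_ctx B \<in> borel_measurable (ctx_ref B) \<and>
     (\<forall>x\<in>space (ctx_ref B). 0 \<le> p_ctx B x) \<and>
     (\<integral>\<^sup>+ x. ennreal (p_ctx B x) \<partial>ctx_ref B) = 1 \<and>
     cond_density (ctx_ref B \<Otimes>\<^sub>M act_ref B) (emb_ref B) (p_emb B) \<and>
     cond_density (ctx_ref B \<Otimes>\<^sub>M act_ref B \<Otimes>\<^sub>M emb_ref B) (out_ref B) (p_out B)"

text \<open>Policies take the context first: \<open>\<pi> x a\<close> stands for \<open>\<pi>(a | x)\<close>.\<close>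

definition policy :: "('x, 'a, 'e) bandit \<Rightarrow> ('x \<Rightarrow> 'a \<Rightarrow> real) \<Rightarrow> bool" where
  "policy B \<pi> \<longleftrightarrow> cond_density (ctx_ref B) (act_ref B) \<pi>"

definition joint_ref :: "('x, 'a, 'e) bandit \<Rightarrow> ('x \<times> 'a \<times> 'e \<times> real) measure" where
  "joint_ref B = ctx_ref B \<Otimes>\<^sub>M act_ref B \<Otimes>\<^sub>M emb_ref B \<Otimes>\<^sub>M out_ref B"

definition joint_density ::
    "('x, 'a, 'e) bandit \<Rightarrow> ('x \<Rightarrow> 'a \<Rightarrow> real) \<Rightarrow> 'x \<times> 'a \<times> 'e \<times> real \<Rightarrow> real" where
  "joint_density B \<pi> = (\<lambda>(x, a, e, y).
     p_ctx B x * \<pi> x a * p_emb B (x, a) e * p_out B (x, a, e) y)"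

definition joint_law ::
    "('x, 'a, 'e) bandit \<Rightarrow> ('x \<Rightarrow> 'a \<Rightarrow> real) \<Rightarrow> ('x \<times> 'a \<times> 'e \<times> real) measure" where
  "joint_law B \<pi> = density (joint_ref B) (\<lambda>z. ennreal (joint_density B \<pi> z))"

text \<open>
  Marginal densities of \<open>(E, X)\<close> and of \<open>Y\<close>.  On the null set of points where the integral diverges,
  the Bochner integral returns 0, so these are everywhere finite versions of the marginals.
\<close>

definition density_EX ::
    "('x, 'a, 'e) bandit \<Rightarrow> ('x \<Rightarrow> 'a \<Rightarrow> real) \<Rightarrow> 'e \<Rightarrow> 'x \<Rightarrow> real" where
  "density_EX B \<pi> e x =
     (\<integral>(a, y). joint_density B \<pi> (x, a, e, y) \<partial>(act_ref B \<Otimes>\<^sub>M out_ref B))"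

definition density_Y ::
    "('x, 'a, 'e) bandit \<Rightarrow> ('x \<Rightarrow> 'a \<Rightarrow> real) \<Rightarrow> real \<Rightarrow> real" where
  "density_Y B \<pi> y =
     (\<integral>(x, a, e). joint_density B \<pi> (x, a, e, y)
        \<partial>(ctx_ref B \<Otimes>\<^sub>M act_ref B \<Otimes>\<^sub>M emb_ref B))"

text \<open>
  Conditional independence of \<open>Y\<close> and \<open>A\<close> given \<open>(X, E)\<close> under policy \<open>\<pi>\<close>, i.e. the Bayesian
  network \<open>(X, A) \<rightarrow> (X, E) \<rightarrow> Y\<close>: the joint density factorizes as
  \<open>p(x) \<pi>(a | x) p(e | x, a) p(y | x, e)\<close>, with \<open>q\<close> playing the role of \<open>p(y | x, e)\<close>.
\<close>

definition Y_indep_A_given_XE ::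
    "('x, 'a, 'e) bandit \<Rightarrow> ('x \<Rightarrow> 'a \<Rightarrow> real) \<Rightarrow> bool" where
  "Y_indep_A_given_XE B \<pi> \<longleftrightarrow>
     (\<exists>q. cond_density (ctx_ref B \<Otimes>\<^sub>M emb_ref B) (out_ref B) q \<and>
        (AE (x, a, e, y) in joint_ref B.
           joint_density B \<pi> (x, a, e, y) =
             p_ctx B x * \<pi> x a * p_emb B (x, a) e * q (x, e) y))"

text \<open>
  Estimators, as functions of the sample size \<open>n\<close> and the sample \<open>d 1, \<dots>, d n\<close>; \<open>\<pi>b\<close> is the behaviour
  policy and \<open>\<pi>t\<close> the target policy.  Weights with denominator 0 are 0 by the convention \<open>r / 0 = 0\<close>;
  this only concerns sample values of probability 0 under \<open>\<pi>b\<close>.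
\<close>

definition IPW ::
    "('x \<Rightarrow> 'a \<Rightarrow> real) \<Rightarrow> ('x \<Rightarrow> 'a \<Rightarrow> real) \<Rightarrow> nat
      \<Rightarrow> (nat \<Rightarrow> 'x \<times> 'a \<times> 'e \<times> real) \<Rightarrow> real" where
  "IPW \<pi>b \<pi>t n d =
     (1 / real n) * (\<Sum>i = 1..n. case d i of (x, a, e, y) \<Rightarrow> \<pi>t x a / \<pi>b x a * y)"

definition MIPS ::
    "('x, 'a, 'e) bandit \<Rightarrow> ('x \<Rightarrow> 'a \<Rightarrow> real) \<Rightarrow> ('x \<Rightarrow> 'a \<Rightarrow> real) \<Rightarrow> nat
      \<Rightarrow> (nat \<Rightarrow> 'x \<times> 'a \<times> 'e \<times> real) \<Rightarrow> real" where
  "MIPS B \<pi>b \<pi>t n d =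
     (1 / real n) *
       (\<Sum>i = 1..n. case d i of (x, a, e, y) \<Rightarrow> density_EX B \<pi>t e x / density_EX B \<pi>b e x * y)"

definition MR ::
    "('x, 'a, 'e) bandit \<Rightarrow> ('x \<Rightarrow> 'a \<Rightarrow> real) \<Rightarrow> ('x \<Rightarrow> 'a \<Rightarrow> real) \<Rightarrow> nat
      \<Rightarrow> (nat \<Rightarrow> 'x \<times> 'a \<times> 'e \<times> real) \<Rightarrow> real" where
  "MR B \<pi>b \<pi>t n d =
     (1 / real n) *
       (\<Sum>i = 1..n. case d i of (x, a, e, y) \<Rightarrow> density_Y B \<pi>t y / density_Y B \<pi>b y * y)"

definition finite_mean_and_variance :: "'w measure \<Rightarrow> ('w \<Rightarrow> real) \<Rightarrow> bool" where
  "finite_mean_and_variance M f \<longleftrightarrow>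
     integrable M f \<and> integrable M (\<lambda>\<omega>. (f \<omega> - prob_space.expectation M f)\<^sup>2)"

end

theory Submission
  imports Defs
begin

text \<open>
  All three estimators are sample means of \<open>v \<cdot> Y\<close> for a weight \<open>v\<close>, and for each of them
  \<open>E\<^sub>b[g \<cdot> v] = E\<^sub>t[g]\<close> for every \<open>g \<ge> 0\<close> that depends only on a part of the data determined by
  the weight: \<open>(X, A, E, Y)\<close> for \<open>\<rho>\<close>, \<open>(X, E, Y)\<close> for the MIPS weight (this is where
  the factorization is needed) and \<open>Y\<close> for \<open>w\<close>.  Taking \<open>g\<close> to be the positive and negative parts of \<open>Y\<close>
  gives the means.  If \<open>v\<close> is the coarser and \<open>u\<close> the finer of two weights, then \<open>g = v \<cdot> Y\<^sup>2\<close> is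
  admissible for both, so \<open>E\<^sub>b[v\<^sup>2 Y\<^sup>2] = E\<^sub>b[u v Y\<^sup>2]\<close>, and \<open>2 u v \<le> u\<^sup>2 + v\<^sup>2\<close> yields
  \<open>E\<^sub>b[v\<^sup>2 Y\<^sup>2] \<le> E\<^sub>b[u\<^sup>2 Y\<^sup>2]\<close>.  As only the sample means are assumed to have a finite variance, one also
  needs that a square-integrable sum of independent integrable variables has square-integrable summands.
\<close>

subsection \<open>Sample means of independent variables\<close>

text \<open>For fixed x the variable x + Y has mean x, so its second moment is at least x^2.
  Independence makes the joint law a product, so integrating this bound over the law of X gives
  E[X^2] \<le> E[(X + Y)^2].\<close>

lemma (in prob_space) square_integrable_indep_summand:
  fixes X Y :: "'a \<Rightarrow> real"
  assumes indep: "indep_var borel X borel Y"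
    and Y: "integrable M Y" "expectation Y = 0"
    and sq: "integrable M (\<lambda>\<omega>. (X \<omega> + Y \<omega>)\<^sup>2)"
  shows "integrable M (\<lambda>\<omega>. (X \<omega>)\<^sup>2)"
proof -
  have mX [measurable]: "X \<in> borel_measurable M" and mY [measurable]: "Y \<in> borel_measurable M"
    using indep_var_rv1[OF indep] indep_var_rv2[OF indep] by auto
  have joint: "distr M borel X \<Otimes>\<^sub>M distr M borel Y
      = distr M (borel \<Otimes>\<^sub>M borel) (\<lambda>\<omega>. (X \<omega>, Y \<omega>))"
    using indep unfolding indep_var_distribution_eq by simp
  interpret DY: prob_space "distr M borel Y" by (rule prob_space_distr) simp
  \<comment> \<open>Stated in \<open>ennreal\<close>, so that an infinite right-hand side leaves
    nothing to show. Where it is finite, the bound is nonnegativity of the variance of x +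
    Y.\<close>
  have le: "ennreal (x\<^sup>2) \<le> (\<integral>\<^sup>+\<omega>. ennreal ((x + Y \<omega>)\<^sup>2) \<partial>M)" for x
  proof (cases "(\<integral>\<^sup>+\<omega>. ennreal ((x + Y \<omega>)\<^sup>2) \<partial>M) = \<infinity>")
    case False
    then have int: "integrable M (\<lambda>\<omega>. (x + Y \<omega>)\<^sup>2)"
      by (intro integrableI_bounded) (auto simp: less_top)
    have "0 \<le> variance (\<lambda>\<omega>. x + Y \<omega>)" by (rule variance_positive)
    also have "\<dots> = expectation (\<lambda>\<omega>. (x + Y \<omega>)\<^sup>2) - x\<^sup>2"
      by (subst variance_eq) (use Y int in \<open>auto simp: prob_space\<close>)
    finally have "x\<^sup>2 \<le> expectation (\<lambda>\<omega>. (x + Y \<omega>)\<^sup>2)" by simp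
    then show ?thesis
      by (subst nn_integral_eq_integral[OF int]) (auto intro: ennreal_leI)
  qed simp
  have "(\<integral>\<^sup>+\<omega>. ennreal ((X \<omega>)\<^sup>2) \<partial>M) = (\<integral>\<^sup>+x. ennreal (x\<^sup>2) \<partial>distr M borel X)"
    by (subst nn_integral_distr) auto
  also have "\<dots> \<le> (\<integral>\<^sup>+x. \<integral>\<^sup>+y. ennreal ((x + y)\<^sup>2) \<partial>distr M borel Y \<partial>distr M borel X)"
    by (intro nn_integral_mono) (use le in \<open>simp add: nn_integral_distr\<close>)
  also have "\<dots> = (\<integral>\<^sup>+z. ennreal ((fst z + snd z)\<^sup>2) \<partial>(distr M borel X \<Otimes>\<^sub>M distr M borel Y))"
    by (subst DY.nn_integral_fst[symmetric]) auto
  also have "\<dots> = (\<integral>\<^sup>+\<omega>. ennreal ((X \<omega> + Y \<omega>)\<^sup>2) \<partial>M)"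
    unfolding joint by (subst nn_integral_distr) auto
  also have "\<dots> < \<infinity>"
    using sq by (simp add: nn_integral_eq_integral)
  finally show ?thesis
    by (intro integrableI_bounded) auto
qed

text \<open>One variable is added at a time: it is independent of the partial sum, so the mixed
  moment factorizes and the covariance vanishes. Square integrability of the sum is part of the
  induction claim because expanding the variance of the next sum relies on it.\<close>

lemma (in prob_space) variance_sum_indep_vars:
  fixes X :: "'i \<Rightarrow> 'a \<Rightarrow> real"
  assumes "finite I" and "indep_vars (\<lambda>_. borel) X I"
    and "\<And>i. i \<in> I \<Longrightarrow> integrable M (X i)"
    and "\<And>i. i \<in> I \<Longrightarrow> integrable M (\<lambda>\<omega>. (X i \<omega>)\<^sup>2)"
  shows "integrable M (\<lambda>\<omega>. (\<Sum>i\<in>I. X i \<omega>)\<^sup>2) \<and>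
    variance (\<lambda>\<omega>. \<Sum>i\<in>I. X i \<omega>) = (\<Sum>i\<in>I. variance (X i))"
  using assms
proof (induction I rule: finite_induct)
  case empty
  then show ?case by simp
next
  case (insert i I)
  let ?S = "\<lambda>\<omega>. \<Sum>i\<in>I. X i \<omega>"
  have IH: "integrable M (\<lambda>\<omega>. (?S \<omega>)\<^sup>2)" "variance ?S = (\<Sum>i\<in>I. variance (X i))"
    using insert.IH insert.prems indep_vars_subset[OF insert.prems(1), of I] by auto
  have iv: "indep_var borel (X i) borel ?S"
    using indep_vars_sum[OF insert.hyps insert.prems(1)] .
  have iX: "integrable M (X i)" "integrable M (\<lambda>\<omega>. (X i \<omega>)\<^sup>2)" and iS: "integrable M ?S"
    using insert.prems by auto
  have cross: "expectation (\<lambda>\<omega>. X i \<omega> * ?S \<omega>) = expectation (X i) * expectation ?S"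
    "integrable M (\<lambda>\<omega>. X i \<omega> * ?S \<omega>)"
    using indep_var_lebesgue_integral[OF iv iX(1) iS] indep_var_integrable[OF iv iX(1) iS] by auto
  have sq: "(X i \<omega> + ?S \<omega>)\<^sup>2 = (X i \<omega>)\<^sup>2 + (?S \<omega>)\<^sup>2 + 2 * (X i \<omega> * ?S \<omega>)" for \<omega>
    by (simp add: power2_sum)
  have int: "integrable M (\<lambda>\<omega>. (X i \<omega> + ?S \<omega>)\<^sup>2)"
    unfolding sq using iX IH cross by auto
  have "variance (\<lambda>\<omega>. X i \<omega> + ?S \<omega>) = expectation (\<lambda>\<omega>. (X i \<omega> + ?S \<omega>)\<^sup>2) - (expectation (X i) + expectation ?S)\<^sup>2"
    using iX iS int by (subst variance_eq) (auto simp del: Bochner_Integration.integral_sum)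
  also have "\<dots> = variance (X i) + variance ?S"
    using iX iS IH(1) cross unfolding sq
    by (simp add: variance_eq power2_sum del: Bochner_Integration.integral_sum)
  finally show ?case
    using insert.hyps int IH(2) by simp
qed

text \<open>The summands are centred at their common mean. Only the sample mean is assumed to have a
  finite variance, so the second moment of a single term is recovered by splitting off the first
  term: the remaining sum is independent of it and has mean zero. The common law carries the result
  to all terms, and then the variances add up.\<close>

lemma (in prob_space)
  fixes h :: "'b \<Rightarrow> real"
  assumes n: "n \<ge> 1" and indep: "indep_vars (\<lambda>_. N) D {1..n}"
    and law: "\<And>i. i \<in> {1..n} \<Longrightarrow> distr M N (D i) = P"
    and h: "h \<in> borel_measurable N" "integrable P h"
  defines "S \<equiv> \<lambda>\<omega>. (1 / real n) * (\<Sum>i = 1..n. h (D i \<omega>))"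
  shows expectation_sample_mean: "expectation S = integral\<^sup>L P h"
    and square_integrable_sample_mean:
      "integrable M (\<lambda>\<omega>. (S \<omega> - expectation S)\<^sup>2) \<Longrightarrow> integrable P (\<lambda>z. (h z)\<^sup>2)"
    and variance_sample_mean:
      "integrable M (\<lambda>\<omega>. (S \<omega> - expectation S)\<^sup>2) \<Longrightarrow>
       variance S = (integral\<^sup>L P (\<lambda>z. (h z)\<^sup>2) - (integral\<^sup>L P h)\<^sup>2) / real n"
proof -
  note h(1)[measurable]
  define m where "m = integral\<^sup>L P h"
  let ?X = "\<lambda>i \<omega>. h (D i \<omega>) - m"
  have D [measurable]: "D i \<in> measurable M N" if "i \<in> {1..n}" for i
    using indep that unfolding indep_vars_def by auto
  have tr: "integrable M (\<lambda>\<omega>. f (D i \<omega>)) \<longleftrightarrow> integrable P f"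
    "expectation (\<lambda>\<omega>. f (D i \<omega>)) = integral\<^sup>L P f"
    if "i \<in> {1..n}" "f \<in> borel_measurable N" for f :: "'b \<Rightarrow> real" and i
    using that law[OF that(1)] integrable_distr_eq[OF D[OF that(1)] that(2)]
      integral_distr[OF D[OF that(1)] that(2)] by auto
  have iX: "integrable M (?X i)" "expectation (?X i) = 0" if "i \<in> {1..n}" for i
    using tr[OF that h(1)] h(2) by (auto simp: m_def prob_space)
  have ind: "indep_vars (\<lambda>_. borel) ?X {1..n}"
    by (rule indep_vars_compose2[OF indep]) simp
  \<comment> \<open>This is where n \<ge> 1 enters: n copies of \<open>m\<close>, divided by n, give
    \<open>m\<close>.\<close>
  have S: "S \<omega> = m + (1 / real n) * (\<Sum>i = 1..n. ?X i \<omega>)" for \<omega>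
    using n by (simp add: S_def sum_subtractf field_simps)
  show ES: "expectation S = integral\<^sup>L P h"
  proof -
    have "integrable M (\<lambda>\<omega>. \<Sum>i = 1..n. ?X i \<omega>)"
      by (rule Bochner_Integration.integrable_sum) (rule iX)
    moreover have "expectation (\<lambda>\<omega>. \<Sum>i = 1..n. ?X i \<omega>) = (\<Sum>i = 1..n. expectation (?X i))"
      by (rule Bochner_Integration.integral_sum) (rule iX)
    ultimately have "expectation S = m + (1 / real n) * (\<Sum>i = 1..n. expectation (?X i))"
      unfolding S by (simp add: prob_space)
    also have "(\<Sum>i = 1..n. expectation (?X i)) = 0"
      using iX(2) by (intro sum.neutral) auto
    finally show ?thesis by (simp add: m_def)
  qed
  have h2: "integrable P (\<lambda>z. (h z)\<^sup>2)" 
    and v: "variance S = (integral\<^sup>L P (\<lambda>z. (h z)\<^sup>2) - m\<^sup>2) / real n"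
    if "integrable M (\<lambda>\<omega>. (S \<omega> - expectation S)\<^sup>2)"
  proof -
    \<comment> \<open>The factor n^2 cancels the 1/n of the sample mean and leaves the square of the
      sum of the centred terms.\<close>
    have "integrable M (\<lambda>\<omega>. (real n)\<^sup>2 * (S \<omega> - expectation S)\<^sup>2)"
      using that by simp
    then have sq: "integrable M (\<lambda>\<omega>. (\<Sum>i = 1..n. ?X i \<omega>)\<^sup>2)"
      unfolding ES m_def[symmetric] S using n
      by (simp add: power_divide cong: Bochner_Integration.integrable_cong)
    \<comment> \<open>For n = 1 the second sum is empty; the constant 0 is still an independent
      summand of mean zero.\<close>
    have split: "(\<Sum>i = 1..n. ?X i \<omega>) = ?X 1 \<omega> + (\<Sum>i = 2..n. ?X i \<omega>)" for \<omega>
      using n by (simp add: sum.atLeast_Suc_atMost numeral_2_eq_2)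
    have "indep_var borel (?X 1) borel (\<lambda>\<omega>. \<Sum>i\<in>{2..n}. ?X i \<omega>)"
      by (rule indep_vars_sum) (use n in \<open>auto intro: indep_vars_subset[OF ind]\<close>)
    then have "integrable M (\<lambda>\<omega>. (?X 1 \<omega>)\<^sup>2)"
      by (rule square_integrable_indep_summand) (use iX sq split in auto)
    then have P2: "integrable P (\<lambda>z. (h z - m)\<^sup>2)"
      using tr(1)[of 1 "\<lambda>z. (h z - m)\<^sup>2"] n by simp
    have P: "prob_space P"
      using law[of 1] prob_space_distr[OF D[of 1]] n by simp
    \<comment> \<open>The integrand is the square of \<open>h z\<close>, written through the centred
      square; the constant is integrable because \<open>P\<close> is a probability measure.\<close>
    have "integrable P (\<lambda>z. (h z - m)\<^sup>2 + 2 * m * h z - m\<^sup>2)"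
      using P2 h(2) P by (auto intro!: finite_measure.integrable_const prob_space.axioms(1))
    then show h2: "integrable P (\<lambda>z. (h z)\<^sup>2)"
      by (simp add: power2_diff cong: Bochner_Integration.integrable_cong)
    have vX: "integrable M (\<lambda>\<omega>. (?X i \<omega>)\<^sup>2)"
      "variance (?X i) = integral\<^sup>L P (\<lambda>z. (h z)\<^sup>2) - m\<^sup>2" if i: "i \<in> {1..n}" for i
    proof -
      show "integrable M (\<lambda>\<omega>. (?X i \<omega>)\<^sup>2)"
        using tr(1)[OF i, of "\<lambda>z. (h z - m)\<^sup>2"] P2 by simp
      have "variance (?X i) = integral\<^sup>L P (\<lambda>z. (h z - m)\<^sup>2)"
        using iX(2)[OF i] tr(2)[OF i, of "\<lambda>z. (h z - m)\<^sup>2"] by simp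
      also have "\<dots> = integral\<^sup>L P (\<lambda>z. (h z)\<^sup>2) - m\<^sup>2"
        unfolding m_def by (rule prob_space.variance_eq[OF P h(2) h2])
      finally show "variance (?X i) = integral\<^sup>L P (\<lambda>z. (h z)\<^sup>2) - m\<^sup>2" .
    qed
    have "variance S = variance (\<lambda>\<omega>. (1 / real n) * (\<Sum>i = 1..n. ?X i \<omega>))"
      unfolding ES m_def[symmetric] S using iX by (simp add: prob_space)
    also have "\<dots> = (1 / real n)\<^sup>2 * variance (\<lambda>\<omega>. \<Sum>i = 1..n. ?X i \<omega>)"
      using iX by (simp add: power_divide)
    also have "variance (\<lambda>\<omega>. \<Sum>i = 1..n. ?X i \<omega>) = (\<Sum>i = 1..n. variance (?X i))"
      using variance_sum_indep_vars[OF _ ind] iX vX by blast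
    also have "\<dots> = real n * (integral\<^sup>L P (\<lambda>z. (h z)\<^sup>2) - m\<^sup>2)"
      using vX by simp
    finally show "variance S = (integral\<^sup>L P (\<lambda>z. (h z)\<^sup>2) - m\<^sup>2) / real n"
      using n by (simp add: power2_eq_square)
  qed
  show "integrable M (\<lambda>\<omega>. (S \<omega> - expectation S)\<^sup>2) \<Longrightarrow> integrable P (\<lambda>z. (h z)\<^sup>2)"
    by (rule h2)
  show "integrable M (\<lambda>\<omega>. (S \<omega> - expectation S)\<^sup>2) \<Longrightarrow>
       variance S = (integral\<^sup>L P (\<lambda>z. (h z)\<^sup>2) - (integral\<^sup>L P h)\<^sup>2) / real n"
    using v by (simp add: m_def)
qed

subsection \<open>Ratios of marginal densities\<close>

text \<open>A finite total integral leaves only a null set of x whose section has an infinite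
  integral. Off this set the section is integrable, so the Bochner integral is the true value and
  not the default 0.\<close>

lemma marginal_density:
  fixes f :: "'a \<times> 'b \<Rightarrow> real"
  assumes "sigma_finite_measure K2"
    and [measurable]: "f \<in> borel_measurable (K1 \<Otimes>\<^sub>M K2)"
    and nonneg: "\<And>z. z \<in> space (K1 \<Otimes>\<^sub>M K2) \<Longrightarrow> 0 \<le> f z"
    and fin: "(\<integral>\<^sup>+z. ennreal (f z) \<partial>(K1 \<Otimes>\<^sub>M K2)) \<noteq> \<infinity>"
  shows "AE x in K1. ennreal (\<integral>y. f (x, y) \<partial>K2) = (\<integral>\<^sup>+y. ennreal (f (x, y)) \<partial>K2)"
proof -
  interpret K2: sigma_finite_measure K2 by fact
  have "AE x in K1. (\<integral>\<^sup>+y. ennreal (f (x, y)) \<partial>K2) \<noteq> \<infinity>"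
    by (rule nn_integral_PInf_AE) (use fin K2.nn_integral_fst[of "\<lambda>z. ennreal (f z)" K1] in auto)
  then show ?thesis
  proof (rule AE_mp, intro AE_I2 impI)
    fix x assume x: "x \<in> space K1" and *: "(\<integral>\<^sup>+y. ennreal (f (x, y)) \<partial>K2) \<noteq> \<infinity>"
    have f0: "0 \<le> f (x, y)" if "y \<in> space K2" for y
      using nonneg[of "(x, y)"] x that by (simp add: space_pair_measure)
    have "integrable K2 (\<lambda>y. f (x, y))"
      by (rule integrableI_nonneg) (use x f0 * in \<open>auto simp: less_top\<close>)
    then show "ennreal (\<integral>y. f (x, y) \<partial>K2) = (\<integral>\<^sup>+y. ennreal (f (x, y)) \<partial>K2)"
      using f0 by (subst nn_integral_eq_integral) auto
  qed
qed

text \<open>Change of measure on the first factor. Once the second variable is integrated out, g is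
  integrated against the marginal m' of f' on the left and against (m' / m) * m on the right. These
  could differ only where m = 0, and there \<open>ac\<close> makes m' vanish almost
  everywhere.\<close>

lemma nn_integral_marginal_ratio:
  fixes f f' :: "'a \<times> 'b \<Rightarrow> real" and g :: "'a \<Rightarrow> ennreal"
  assumes K2: "sigma_finite_measure K2"
    and mf [measurable]: "f \<in> borel_measurable (K1 \<Otimes>\<^sub>M K2)"
    and mf' [measurable]: "f' \<in> borel_measurable (K1 \<Otimes>\<^sub>M K2)"
    and nonneg: "\<And>z. z \<in> space (K1 \<Otimes>\<^sub>M K2) \<Longrightarrow> 0 \<le> f z"
      "\<And>z. z \<in> space (K1 \<Otimes>\<^sub>M K2) \<Longrightarrow> 0 \<le> f' z"
    and fin: "(\<integral>\<^sup>+z. ennreal (f z) \<partial>(K1 \<Otimes>\<^sub>M K2)) \<noteq> \<infinity>"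
      "(\<integral>\<^sup>+z. ennreal (f' z) \<partial>(K1 \<Otimes>\<^sub>M K2)) \<noteq> \<infinity>"
    and ac: "\<And>z. z \<in> space (K1 \<Otimes>\<^sub>M K2) \<Longrightarrow> f z = 0 \<Longrightarrow> f' z = 0"
    and [measurable]: "g \<in> borel_measurable K1"
  shows "(\<integral>\<^sup>+z. g (fst z) * ennreal (f' z) \<partial>(K1 \<Otimes>\<^sub>M K2)) =
    (\<integral>\<^sup>+z. g (fst z) * ennreal ((\<integral>y. f' (fst z, y) \<partial>K2) / (\<integral>y. f (fst z, y) \<partial>K2))
       * ennreal (f z) \<partial>(K1 \<Otimes>\<^sub>M K2))"
proof -
  interpret K2: sigma_finite_measure K2 by fact
  define m where "m x = (\<integral>y. f (x, y) \<partial>K2)" for x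
  define m' where "m' x = (\<integral>y. f' (x, y) \<partial>K2)" for x
  have [measurable]: "m \<in> borel_measurable K1" "m' \<in> borel_measurable K1"
    unfolding m_def m'_def by measurable
  have AE1: "AE x in K1. ennreal (m x) = (\<integral>\<^sup>+y. ennreal (f (x, y)) \<partial>K2)"
    unfolding m_def by (rule marginal_density[OF K2 mf nonneg(1) fin(1)])
  have AE2: "AE x in K1. ennreal (m' x) = (\<integral>\<^sup>+y. ennreal (f' (x, y)) \<partial>K2)"
    unfolding m'_def by (rule marginal_density[OF K2 mf' nonneg(2) fin(2)])
  have m0: "0 \<le> m x" "0 \<le> m' x" if "x \<in> space K1" for x
    using nonneg that unfolding m_def m'_def
    by (auto intro!: Bochner_Integration.integral_nonneg simp: space_pair_measure)
  have "(\<integral>\<^sup>+z. g (fst z) * ennreal (f' z) \<partial>(K1 \<Otimes>\<^sub>M K2)) =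
      (\<integral>\<^sup>+x. \<integral>\<^sup>+y. g x * ennreal (f' (x, y)) \<partial>K2 \<partial>K1)"
    by (subst K2.nn_integral_fst[symmetric]) auto
  also have "\<dots> = (\<integral>\<^sup>+x. \<integral>\<^sup>+y. g x * ennreal (m' x / m x) * ennreal (f (x, y)) \<partial>K2 \<partial>K1)"
  proof (rule nn_integral_cong_AE)
    show "AE x in K1. (\<integral>\<^sup>+y. g x * ennreal (f' (x, y)) \<partial>K2)
      = (\<integral>\<^sup>+y. g x * ennreal (m' x / m x) * ennreal (f (x, y)) \<partial>K2)"
      using AE1 AE2 AE_space
    proof eventually_elim
      case (elim x)
      show ?case
      proof -
        note True = \<open>x \<in> space K1\<close>
        have [measurable]: "(\<lambda>y. f (x, y)) \<in> borel_measurable K2" "(\<lambda>y. f' (x, y)) \<in> borel_measurable K2"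
          using True by auto
        \<comment> \<open>If \<open>m x = 0\<close>, then \<open>f (x, y)\<close> vanishes for
          almost every y, hence so does \<open>f' (x, y)\<close> by \<open>ac\<close>, and
          \<open>m' x = 0\<close>. The value of the quotient by 0 is then irrelevant.\<close>
        have "ennreal (m' x) = ennreal (m' x / m x) * ennreal (m x)"
        proof (cases "m x = 0")
          case z: True
          then have "(\<integral>\<^sup>+y. ennreal (f (x, y)) \<partial>K2) = 0"
            using elim by simp
          then have "AE y in K2. ennreal (f (x, y)) = 0"
            by (subst (asm) nn_integral_0_iff_AE) auto
          then have "AE y in K2. ennreal (f' (x, y)) = 0"
          proof (rule AE_mp, intro AE_I2 impI)
            fix y assume "y \<in> space K2" "ennreal (f (x, y)) = 0"
            then show "ennreal (f' (x, y)) = 0"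
              using nonneg(1)[of "(x, y)"] ac[of "(x, y)"] True
              by (auto simp: space_pair_measure)
          qed
          then have "(\<integral>\<^sup>+y. ennreal (f' (x, y)) \<partial>K2) = 0"
            by (subst nn_integral_0_iff_AE) auto
          then show ?thesis using elim z by simp
        next
          case False
          then show ?thesis
            using m0[OF True] by (simp add: ennreal_mult'[symmetric])
        qed
        then show ?thesis
          using elim by (simp add: nn_integral_cmult mult.assoc)
      qed
    qed
  qed
  also have "\<dots> = (\<integral>\<^sup>+z. g (fst z) * ennreal (m' (fst z) / m (fst z)) * ennreal (f z) \<partial>(K1 \<Otimes>\<^sub>M K2))"
    by (subst K2.nn_integral_fst[symmetric]) auto
  finally show ?thesis unfolding m_def m'_def .
qed

section \<open>Reorderings of the fourfold integral\<close>

lemma nn_integral_pair4: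
  assumes "sigma_finite_measure A" "sigma_finite_measure E" "sigma_finite_measure Y"
    and [measurable]: "f \<in> borel_measurable (C \<Otimes>\<^sub>M A \<Otimes>\<^sub>M E \<Otimes>\<^sub>M Y)"
  shows "(\<integral>\<^sup>+z. f z \<partial>(C \<Otimes>\<^sub>M A \<Otimes>\<^sub>M E \<Otimes>\<^sub>M Y)) =
    (\<integral>\<^sup>+x. \<integral>\<^sup>+a. \<integral>\<^sup>+e. \<integral>\<^sup>+y. f (x, a, e, y) \<partial>Y \<partial>E \<partial>A \<partial>C)"
proof -
  interpret A: sigma_finite_measure A by fact
  interpret E: sigma_finite_measure E by fact
  interpret Y: sigma_finite_measure Y by fact
  interpret EY: pair_sigma_finite E Y ..
  interpret AEY: pair_sigma_finite A "E \<Otimes>\<^sub>M Y" ..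
  show ?thesis
    by (simp add: AEY.nn_integral_fst[symmetric] EY.nn_integral_fst[symmetric]
        Y.nn_integral_fst[symmetric] cong: nn_integral_cong)
qed

text \<open>Prepares for \<open>nn_integral_marginal_ratio\<close>, which takes the marginal on the
  first factor: \<open>density_EX\<close> keeps context and embedding and integrates out action and
  outcome. Only the integrals over actions and embeddings change places.\<close>

lemma nn_integral_pair4_middle_swap:
  assumes "sigma_finite_measure A" "sigma_finite_measure E" "sigma_finite_measure Y"
    and [measurable]: "f \<in> borel_measurable (C \<Otimes>\<^sub>M A \<Otimes>\<^sub>M E \<Otimes>\<^sub>M Y)"
  shows "(\<integral>\<^sup>+z. f z \<partial>(C \<Otimes>\<^sub>M A \<Otimes>\<^sub>M E \<Otimes>\<^sub>M Y)) =
    (\<integral>\<^sup>+((x, e), (a, y)). f (x, a, e, y) \<partial>((C \<Otimes>\<^sub>M E) \<Otimes>\<^sub>M (A \<Otimes>\<^sub>M Y)))"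
proof -
  interpret A: sigma_finite_measure A by fact
  interpret E: sigma_finite_measure E by fact
  interpret Y: sigma_finite_measure Y by fact
  interpret EA: pair_sigma_finite E A ..
  interpret AY: pair_sigma_finite A Y ..
  have "(\<integral>\<^sup>+((x, e), (a, y)). f (x, a, e, y) \<partial>((C \<Otimes>\<^sub>M E) \<Otimes>\<^sub>M (A \<Otimes>\<^sub>M Y))) =
      (\<integral>\<^sup>+x. \<integral>\<^sup>+e. \<integral>\<^sup>+a. \<integral>\<^sup>+y. f (x, a, e, y) \<partial>Y \<partial>A \<partial>E \<partial>C)"
    by (simp add: AY.nn_integral_fst[symmetric] E.nn_integral_fst[symmetric]
        Y.nn_integral_fst[symmetric] split_beta' cong: nn_integral_cong)
  also have "\<dots> = (\<integral>\<^sup>+x. \<integral>\<^sup>+a. \<integral>\<^sup>+e. \<integral>\<^sup>+y. f (x, a, e, y) \<partial>Y \<partial>E \<partial>A \<partial>C)"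
    by (intro nn_integral_cong EA.Fubini'[symmetric]) simp
  also have "\<dots> = (\<integral>\<^sup>+z. f z \<partial>(C \<Otimes>\<^sub>M A \<Otimes>\<^sub>M E \<Otimes>\<^sub>M Y))"
    by (rule nn_integral_pair4[symmetric]) fact+
  finally show ?thesis by simp
qed

text \<open>The counterpart for \<open>density_Y\<close>, which keeps the outcome alone.\<close>

lemma nn_integral_pair4_rotate:
  assumes "sigma_finite_measure C" "sigma_finite_measure A" "sigma_finite_measure E" "sigma_finite_measure Y"
    and [measurable]: "f \<in> borel_measurable (C \<Otimes>\<^sub>M A \<Otimes>\<^sub>M E \<Otimes>\<^sub>M Y)"
  shows "(\<integral>\<^sup>+z. f z \<partial>(C \<Otimes>\<^sub>M A \<Otimes>\<^sub>M E \<Otimes>\<^sub>M Y)) =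
    (\<integral>\<^sup>+(y, (x, a, e)). f (x, a, e, y) \<partial>(Y \<Otimes>\<^sub>M (C \<Otimes>\<^sub>M A \<Otimes>\<^sub>M E)))"
proof -
  interpret C: sigma_finite_measure C by fact
  interpret A: sigma_finite_measure A by fact
  interpret E: sigma_finite_measure E by fact
  interpret Y: sigma_finite_measure Y by fact
  interpret AE: pair_sigma_finite A E ..
  interpret CAE: pair_sigma_finite C "A \<Otimes>\<^sub>M E" ..
  interpret YC: pair_sigma_finite Y "C \<Otimes>\<^sub>M A \<Otimes>\<^sub>M E" ..
  have "(\<integral>\<^sup>+(y, (x, a, e)). f (x, a, e, y) \<partial>(Y \<Otimes>\<^sub>M (C \<Otimes>\<^sub>M A \<Otimes>\<^sub>M E))) =
      (\<integral>\<^sup>+(x, a, e). \<integral>\<^sup>+y. f (x, a, e, y) \<partial>Y \<partial>(C \<Otimes>\<^sub>M A \<Otimes>\<^sub>M E))"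
    by (subst YC.nn_integral_snd[symmetric]) (auto simp: split_beta')
  also have "\<dots> = (\<integral>\<^sup>+x. \<integral>\<^sup>+a. \<integral>\<^sup>+e. \<integral>\<^sup>+y. f (x, a, e, y) \<partial>Y \<partial>E \<partial>A \<partial>C)"
    by (simp add: AE.nn_integral_fst[symmetric] E.nn_integral_fst[symmetric] cong: nn_integral_cong)
  also have "\<dots> = (\<integral>\<^sup>+z. f z \<partial>(C \<Otimes>\<^sub>M A \<Otimes>\<^sub>M E \<Otimes>\<^sub>M Y))"
    by (rule nn_integral_pair4[symmetric]) fact+
  finally show ?thesis by simp
qed

subsection \<open>Reweighting\<close>

text \<open>Taking \<open>h\<close> to be an indicator shows that \<open>Y\<close> has the same law
  under \<open>Q\<close> as under the measure with density \<open>v\<close> with respect to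
  \<open>P\<close>. Integrability and mean depend on the law only, so both transfer.\<close>

lemma
  fixes Y v :: "'a \<Rightarrow> real"
  assumes [measurable]: "Y \<in> borel_measurable P" "v \<in> borel_measurable P"
    and sets: "sets Q = sets P"
    and v: "\<And>z. z \<in> space P \<Longrightarrow> 0 \<le> v z"
    and eq: "\<And>h. h \<in> borel_measurable borel \<Longrightarrow>
      (\<integral>\<^sup>+z. h (Y z) \<partial>Q) = (\<integral>\<^sup>+z. h (Y z) * ennreal (v z) \<partial>P)"
    and int: "integrable Q Y"
  shows integrable_reweighted: "integrable P (\<lambda>z. v z * Y z)"
    and integral_reweighted: "(\<integral>z. v z * Y z \<partial>P) = (\<integral>z. Y z \<partial>Q)"
proof -
  have [measurable]: "Y \<in> borel_measurable Q"
    using assms(1) by (simp add: measurable_def sets sets_eq_imp_space_eq[OF sets])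
  have AEv: "AE z in P. 0 \<le> v z" using v by (rule AE_I2)
  have D: "distr Q borel Y = distr (density P v) borel Y"
  proof (rule measure_eqI)
    fix A assume "A \<in> sets (distr Q borel Y)"
    then have A [measurable]: "A \<in> sets borel" by simp
    have "emeasure (distr Q borel Y) A = (\<integral>\<^sup>+z. indicator A (Y z) \<partial>Q)"
      using nn_integral_distr[of Y Q borel "indicator A"] by simp
    also have "\<dots> = (\<integral>\<^sup>+z. indicator A (Y z) * ennreal (v z) \<partial>P)"
      by (rule eq) simp
    also have "\<dots> = (\<integral>\<^sup>+z. indicator A (Y z) \<partial>density P v)"
      by (subst nn_integral_density) (auto simp: mult.commute)
    also have "\<dots> = emeasure (distr (density P v) borel Y) A"
      using nn_integral_distr[of Y "density P v" borel "indicator A"] by simp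
    finally show "emeasure (distr Q borel Y) A = emeasure (distr (density P v) borel Y) A" .
  qed simp
  have "integrable (distr Q borel Y) (\<lambda>y. y)"
    using int by (simp add: integrable_distr_eq)
  then have "integrable (density P v) Y"
    unfolding D by (simp add: integrable_distr_eq)
  then show "integrable P (\<lambda>z. v z * Y z)"
    using AEv by (simp add: integrable_real_density)
  have "(\<integral>z. Y z \<partial>Q) = (\<integral>y. y \<partial>distr Q borel Y)"
    by (simp add: integral_distr)
  also have "\<dots> = (\<integral>z. Y z \<partial>density P v)"
    unfolding D by (simp add: integral_distr)
  also have "\<dots> = (\<integral>z. v z * Y z \<partial>P)"
    using AEv by (simp add: integral_real_density)
  finally show "(\<integral>z. v z * Y z \<partial>P) = (\<integral>z. Y z \<partial>Q)" ..
qed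

text \<open>By \<open>eq\<close> the second moment of v * Y is the mixed moment of u * Y and v * Y,
  which is at most the average of the two second moments. As the second moment of v * Y is finite,
  half of it can be subtracted on both sides.\<close>

lemma second_moment_reweighted_le:
  fixes u v Y :: "'a \<Rightarrow> real"
  assumes [measurable]: "u \<in> borel_measurable P" "v \<in> borel_measurable P" "Y \<in> borel_measurable P"
    and nonneg: "\<And>z. z \<in> space P \<Longrightarrow> 0 \<le> u z" "\<And>z. z \<in> space P \<Longrightarrow> 0 \<le> v z"
    and int: "integrable P (\<lambda>z. (u z * Y z)\<^sup>2)" "integrable P (\<lambda>z. (v z * Y z)\<^sup>2)"
    and eq: "(\<integral>\<^sup>+z. ennreal (v z * (Y z)\<^sup>2) * ennreal (v z) \<partial>P) =
      (\<integral>\<^sup>+z. ennreal (v z * (Y z)\<^sup>2) * ennreal (u z) \<partial>P)"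
  shows "(\<integral>z. (v z * Y z)\<^sup>2 \<partial>P) \<le> (\<integral>z. (u z * Y z)\<^sup>2 \<partial>P)"
proof -
  have am: "2 * (u z * v z * (Y z)\<^sup>2) \<le> (u z * Y z)\<^sup>2 + (v z * Y z)\<^sup>2" for z
    using zero_le_power2[of "u z * Y z - v z * Y z"]
    by (simp add: power2_eq_square algebra_simps)
  \<comment> \<open>The mixed term is nonnegative and dominated by the sum of the two squares, so
    the argument can move from \<open>ennreal\<close> to real integrals.\<close>
  have uv: "integrable P (\<lambda>z. u z * v z * (Y z)\<^sup>2)"
  proof (rule Bochner_Integration.integrable_bound)
    show "integrable P (\<lambda>z. (u z * Y z)\<^sup>2 + (v z * Y z)\<^sup>2)" using int by simp
    show "AE z in P. norm (u z * v z * (Y z)\<^sup>2) \<le> norm ((u z * Y z)\<^sup>2 + (v z * Y z)\<^sup>2)"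
    proof (rule AE_I2)
      fix z assume "z \<in> space P"
      then have "0 \<le> u z * v z * (Y z)\<^sup>2" using nonneg by simp
      with am[of z] show "norm (u z * v z * (Y z)\<^sup>2) \<le> norm ((u z * Y z)\<^sup>2 + (v z * Y z)\<^sup>2)"
        by (simp add: abs_of_nonneg)
    qed
  qed simp
  have "ennreal (\<integral>z. (v z * Y z)\<^sup>2 \<partial>P) = (\<integral>\<^sup>+z. ennreal (v z * (Y z)\<^sup>2) * ennreal (v z) \<partial>P)"
    by (subst nn_integral_eq_integral[OF int(2), symmetric])
      (auto intro!: nn_integral_cong simp: nonneg ennreal_mult'[symmetric] power_mult_distrib power2_eq_square[of "v _"] mult_ac)
  also have "\<dots> = ennreal (\<integral>z. u z * v z * (Y z)\<^sup>2 \<partial>P)"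
    unfolding eq using nonneg
    by (subst nn_integral_eq_integral[OF uv, symmetric])
      (auto intro!: nn_integral_cong simp: ennreal_mult'[symmetric] mult_ac)
  finally have "(\<integral>z. (v z * Y z)\<^sup>2 \<partial>P) = (\<integral>z. u z * v z * (Y z)\<^sup>2 \<partial>P)"
    using nonneg by (subst (asm) ennreal_inj) (auto intro!: Bochner_Integration.integral_nonneg)
  moreover have "2 * (\<integral>z. u z * v z * (Y z)\<^sup>2 \<partial>P) \<le> (\<integral>z. (u z * Y z)\<^sup>2 + (v z * Y z)\<^sup>2 \<partial>P)"
    unfolding Bochner_Integration.integral_mult_right_zero[symmetric]
    using int uv am by (intro integral_mono) auto
  ultimately show ?thesis using int by simp
qed

section \<open>Measurability and basic properties of conditional densities\<close>

lemma measurable_uncurry2: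
  assumes "(\<lambda>(x, y). g x y) \<in> measurable (M1 \<Otimes>\<^sub>M M2) L"
    and "f1 \<in> measurable N M1" "f2 \<in> measurable N M2"
  shows "(\<lambda>w. g (f1 w) (f2 w)) \<in> measurable N L"
  using measurable_compose[OF measurable_Pair[OF assms(2,3)] assms(1)] by simp

lemma measurable_uncurry3:
  assumes "(\<lambda>(x, y, z). g x y z) \<in> measurable (M1 \<Otimes>\<^sub>M M2 \<Otimes>\<^sub>M M3) L"
    and "f1 \<in> measurable N M1" "f2 \<in> measurable N M2" "f3 \<in> measurable N M3"
  shows "(\<lambda>w. g (f1 w) (f2 w) (f3 w)) \<in> measurable N L"
  using measurable_compose[OF measurable_Pair[OF assms(2) measurable_Pair[OF assms(3,4)]] assms(1)]
  by simp

lemma cond_density_measurable: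
  assumes "cond_density C D k" "f \<in> measurable N C" "g \<in> measurable N D"
  shows "(\<lambda>z. k (f z) (g z)) \<in> borel_measurable N"
  using assms unfolding cond_density_def by (blast intro: measurable_uncurry2)

lemma cond_density_nonneg:
  "cond_density C D k \<Longrightarrow> c \<in> space C \<Longrightarrow> d \<in> space D \<Longrightarrow> 0 \<le> k c d"
  by (simp add: cond_density_def)

lemma cond_density_mass:
  "cond_density C D k \<Longrightarrow> c \<in> space C \<Longrightarrow> (\<integral>\<^sup>+ d. ennreal (k c d) \<partial>D) = 1"
  by (simp add: cond_density_def)

subsection \<open>The bandit model\<close>

text \<open>Two policies over one model, with a single \<open>q\<close> in the role of p(y | x, e).
  It is a version belonging to the behaviour policy; \<open>factorized_target\<close> shows that the
  same \<open>q\<close> serves the target policy.\<close>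

locale bandit_policies =
  fixes B :: "('x, 'a, 'e) bandit"
    and \<pi>b \<pi>t :: "'x \<Rightarrow> 'a \<Rightarrow> real"
    and q :: "'x \<times> 'e \<Rightarrow> real \<Rightarrow> real"
  assumes model: "bandit_model B"
    and behaviour: "policy B \<pi>b"
    and target: "policy B \<pi>t"
    and support: "\<And>x a. x \<in> space (ctx_ref B) \<Longrightarrow> a \<in> space (act_ref B) \<Longrightarrow> \<pi>t x a > 0 \<Longrightarrow> \<pi>b x a > 0"
    and q: "cond_density (ctx_ref B \<Otimes>\<^sub>M emb_ref B) (out_ref B) q"
    and factorized: "AE (x, a, e, y) in joint_ref B. joint_density B \<pi>b (x, a, e, y) =
      p_ctx B x * \<pi>b x a * p_emb B (x, a) e * q (x, e) y"
begin

abbreviation "C \<equiv> ctx_ref B"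
abbreviation "A \<equiv> act_ref B"
abbreviation "E \<equiv> emb_ref B"
abbreviation "Y \<equiv> out_ref B"

lemma sigma_finite: "sigma_finite_measure C" "sigma_finite_measure A"
    "sigma_finite_measure E" "sigma_finite_measure Y"
  using model by (auto simp: bandit_model_def)

sublocale C: sigma_finite_measure C by (rule sigma_finite)
sublocale A: sigma_finite_measure A by (rule sigma_finite)
sublocale E: sigma_finite_measure E by (rule sigma_finite)
sublocale Y: sigma_finite_measure Y by (rule sigma_finite)
sublocale AY: pair_sigma_finite A Y ..
sublocale AE: pair_sigma_finite A E ..
sublocale CAE: pair_sigma_finite C "A \<Otimes>\<^sub>M E" ..

lemma emb: "cond_density (C \<Otimes>\<^sub>M A) E (p_emb B)"
  and out: "cond_density (C \<Otimes>\<^sub>M A \<Otimes>\<^sub>M E) Y (p_out B)"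
  and ctx_measurable [measurable]: "p_ctx B \<in> borel_measurable C"
  and ctx_nonneg: "x \<in> space C \<Longrightarrow> 0 \<le> p_ctx B x"
  and ctx_mass: "(\<integral>\<^sup>+ x. ennreal (p_ctx B x) \<partial>C) = 1"
  using model by (auto simp: bandit_model_def)

lemma outcome_measurable: "(\<lambda>y. y) \<in> borel_measurable Y"
proof -
  have "sets Y = sets (restrict_space borel (space Y))"
    using model by (simp add: bandit_model_def)
  from measurable_cong_sets[OF this refl, of borel] show ?thesis
    by (auto intro!: measurable_restrict_space1)
qed

lemmas [measurable (raw)] = cond_density_measurable[OF emb] cond_density_measurable[OF out]
  cond_density_measurable[OF q]

lemma policy_measurable:
  "policy B \<pi> \<Longrightarrow> f \<in> measurable N C \<Longrightarrow> g \<in> measurable N A \<Longrightarrow>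
    (\<lambda>z. \<pi> (f z) (g z)) \<in> borel_measurable N"
  unfolding policy_def by (rule cond_density_measurable)

lemmas [measurable (raw)] = policy_measurable[OF behaviour] policy_measurable[OF target]

lemma joint_density_measurable:
  assumes "policy B \<pi>"
  shows "joint_density B \<pi> \<in> borel_measurable (C \<Otimes>\<^sub>M A \<Otimes>\<^sub>M E \<Otimes>\<^sub>M Y)"
proof -
  note [measurable (raw)] = policy_measurable[OF assms]
  show ?thesis unfolding joint_density_def by measurable
qed

lemma policy_nonneg: "policy B \<pi> \<Longrightarrow> x \<in> space C \<Longrightarrow> a \<in> space A \<Longrightarrow> 0 \<le> \<pi> x a"
  unfolding policy_def by (rule cond_density_nonneg)

lemma joint_density_nonneg:
  assumes "policy B \<pi>" "x \<in> space C" "a \<in> space A" "e \<in> space E" "y \<in> space Y"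
  shows "0 \<le> joint_density B \<pi> (x, a, e, y)"
  using assms ctx_nonneg policy_nonneg cond_density_nonneg[OF emb] cond_density_nonneg[OF out]
  by (auto simp: joint_density_def space_pair_measure)

lemma sets_joint_law [measurable_cong]:
  "sets (joint_law B \<pi>) = sets (C \<Otimes>\<^sub>M A \<Otimes>\<^sub>M E \<Otimes>\<^sub>M Y)"
  by (simp add: joint_law_def joint_ref_def)

lemma space_joint_law: "space (joint_law B \<pi>) = space C \<times> space A \<times> space E \<times> space Y"
  by (simp add: joint_law_def joint_ref_def space_pair_measure)

section \<open>Integrals under the joint law\<close>

lemma nn_integral_joint_law:
  assumes "policy B \<pi>" "f \<in> borel_measurable (C \<Otimes>\<^sub>M A \<Otimes>\<^sub>M E \<Otimes>\<^sub>M Y)"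
  shows "(\<integral>\<^sup>+z. f z \<partial>joint_law B \<pi>) =
    (\<integral>\<^sup>+z. f z * ennreal (joint_density B \<pi> z) \<partial>(C \<Otimes>\<^sub>M A \<Otimes>\<^sub>M E \<Otimes>\<^sub>M Y))"
  unfolding joint_law_def joint_ref_def using assms joint_density_measurable[OF assms(1)]
  by (subst nn_integral_density) (auto simp: mult.commute)

lemma nn_integral_joint_law_iterated:
  assumes "policy B \<pi>" and [measurable]: "f \<in> borel_measurable (C \<Otimes>\<^sub>M A \<Otimes>\<^sub>M E \<Otimes>\<^sub>M Y)"
  shows "(\<integral>\<^sup>+z. f z \<partial>joint_law B \<pi>) =
    (\<integral>\<^sup>+x. \<integral>\<^sup>+a. \<integral>\<^sup>+e. \<integral>\<^sup>+y. f (x, a, e, y) * ennreal (joint_density B \<pi> (x, a, e, y)) \<partial>Y \<partial>E \<partial>A \<partial>C)"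
proof -
  note [measurable] = joint_density_measurable[OF assms(1)]
  show ?thesis
    unfolding nn_integral_joint_law[OF assms]
    by (rule nn_integral_pair4[OF sigma_finite(2-4)]) simp
qed

text \<open>The outcome density integrates to 1 for every (x, a, e), so it drops out of the
  innermost integral.\<close>

lemma nn_integral_joint_law_XAE:
  assumes \<pi>: "policy B \<pi>" and f: "(\<lambda>(x, a, e). f x a e) \<in> borel_measurable (C \<Otimes>\<^sub>M A \<Otimes>\<^sub>M E)"
  shows "(\<integral>\<^sup>+(x, a, e, y). f x a e \<partial>joint_law B \<pi>) =
    (\<integral>\<^sup>+x. \<integral>\<^sup>+a. \<integral>\<^sup>+e. f x a e * ennreal (p_ctx B x * \<pi> x a * p_emb B (x, a) e) \<partial>E \<partial>A \<partial>C)"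
proof -
  note [measurable (raw)] = measurable_uncurry3[OF f]
  have "(\<integral>\<^sup>+(x, a, e, y). f x a e \<partial>joint_law B \<pi>) =
    (\<integral>\<^sup>+x. \<integral>\<^sup>+a. \<integral>\<^sup>+e. \<integral>\<^sup>+y. f x a e * ennreal (joint_density B \<pi> (x, a, e, y)) \<partial>Y \<partial>E \<partial>A \<partial>C)"
    by (subst nn_integral_joint_law_iterated[OF \<pi>]) auto
  also have "\<dots> = (\<integral>\<^sup>+x. \<integral>\<^sup>+a. \<integral>\<^sup>+e. f x a e * ennreal (p_ctx B x * \<pi> x a * p_emb B (x, a) e) \<partial>E \<partial>A \<partial>C)"
  proof (intro nn_integral_cong)
    fix x a e assume sp: "x \<in> space C" "a \<in> space A" "e \<in> space E"
    let ?c = "p_ctx B x * \<pi> x a * p_emb B (x, a) e"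
    have c: "0 \<le> ?c"
      using sp ctx_nonneg policy_nonneg[OF \<pi>] cond_density_nonneg[OF emb]
      by (auto simp: space_pair_measure)
    have "(\<integral>\<^sup>+y. f x a e * ennreal (joint_density B \<pi> (x, a, e, y)) \<partial>Y) =
        (\<integral>\<^sup>+y. f x a e * ennreal ?c * ennreal (p_out B (x, a, e) y) \<partial>Y)"
      by (simp only: joint_density_def prod.case ennreal_mult'[OF c]) (simp only: mult.assoc)
    also have "\<dots> = f x a e * ennreal ?c * (\<integral>\<^sup>+y. ennreal (p_out B (x, a, e) y) \<partial>Y)"
      using sp by (intro nn_integral_cmult) auto
    also have "(\<integral>\<^sup>+y. ennreal (p_out B (x, a, e) y) \<partial>Y) = 1"
      using sp by (intro cond_density_mass[OF out]) (auto simp: space_pair_measure)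
    finally show "(\<integral>\<^sup>+y. f x a e * ennreal (joint_density B \<pi> (x, a, e, y)) \<partial>Y) = f x a e * ennreal ?c"
      by simp
  qed
  finally show ?thesis .
qed

text \<open>The conditional densities integrate to 1 one after the other: outcome, embedding,
  action, context. The total mass 1 also supplies the finiteness conditions of
  \<open>nn_integral_marginal_ratio\<close>.\<close>

lemma emeasure_joint_law:
  assumes \<pi>: "policy B \<pi>"
  shows "emeasure (joint_law B \<pi>) (space (joint_law B \<pi>)) = 1"
proof -
  note [measurable (raw)] = policy_measurable[OF \<pi>]
  have "emeasure (joint_law B \<pi>) (space (joint_law B \<pi>)) = (\<integral>\<^sup>+(x, a, e, y). 1 \<partial>joint_law B \<pi>)"
    by (simp add: split_beta')
  also have "\<dots> = (\<integral>\<^sup>+x. \<integral>\<^sup>+a. \<integral>\<^sup>+e. ennreal (p_ctx B x * \<pi> x a * p_emb B (x, a) e) \<partial>E \<partial>A \<partial>C)"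
    by (subst nn_integral_joint_law_XAE[OF \<pi>]) auto
  also have "\<dots> = (\<integral>\<^sup>+x. \<integral>\<^sup>+a. ennreal (p_ctx B x) * ennreal (\<pi> x a) \<partial>A \<partial>C)"
  proof (intro nn_integral_cong)
    fix x a assume sp: "x \<in> space C" "a \<in> space A"
    have "(\<integral>\<^sup>+e. ennreal (p_ctx B x * \<pi> x a * p_emb B (x, a) e) \<partial>E) =
        (\<integral>\<^sup>+e. ennreal (p_ctx B x) * ennreal (\<pi> x a) * ennreal (p_emb B (x, a) e) \<partial>E)"
      using sp ctx_nonneg policy_nonneg[OF \<pi>] by (simp add: ennreal_mult')
    also have "\<dots> = ennreal (p_ctx B x) * ennreal (\<pi> x a) * (\<integral>\<^sup>+e. ennreal (p_emb B (x, a) e) \<partial>E)"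
      using sp by (intro nn_integral_cmult) auto
    also have "(\<integral>\<^sup>+e. ennreal (p_emb B (x, a) e) \<partial>E) = 1"
      using sp by (intro cond_density_mass[OF emb]) (auto simp: space_pair_measure)
    finally show "(\<integral>\<^sup>+e. ennreal (p_ctx B x * \<pi> x a * p_emb B (x, a) e) \<partial>E) =
        ennreal (p_ctx B x) * ennreal (\<pi> x a)" by simp
  qed
  also have "\<dots> = (\<integral>\<^sup>+x. ennreal (p_ctx B x) \<partial>C)"
  proof (intro nn_integral_cong)
    fix x assume sp: "x \<in> space C"
    have "(\<integral>\<^sup>+a. ennreal (p_ctx B x) * ennreal (\<pi> x a) \<partial>A) =
        ennreal (p_ctx B x) * (\<integral>\<^sup>+a. ennreal (\<pi> x a) \<partial>A)"
      using sp by (intro nn_integral_cmult) auto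
    also have "(\<integral>\<^sup>+a. ennreal (\<pi> x a) \<partial>A) = 1"
      using sp cond_density_mass[OF \<pi>[unfolded policy_def]] by simp
    finally show "(\<integral>\<^sup>+a. ennreal (p_ctx B x) * ennreal (\<pi> x a) \<partial>A) = ennreal (p_ctx B x)" by simp
  qed
  also have "\<dots> = 1" by (rule ctx_mass)
  finally show ?thesis .
qed

section \<open>Passing from the behaviour policy to the target policy\<close>

lemma target_density_eq:
  assumes "x \<in> space C" "a \<in> space A"
  shows "\<pi>t x a = \<pi>t x a / \<pi>b x a * \<pi>b x a"
  \<comment> \<open>Where \<open>\<pi>b x a = 0\<close> the quotient is 0 by convention, and support
    together with nonnegativity forces \<open>\<pi>t x a = 0\<close> as well.\<close>
  using support[OF assms] policy_nonneg[OF target assms]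
  by (cases "\<pi>b x a = 0") (auto simp: less_le)

text \<open>The policy is a single factor of the joint density. The identity holds pointwise and not
  just almost everywhere, so each zero of the behaviour density is a zero of the target density;
  this is the condition \<open>ac\<close> of \<open>nn_integral_marginal_ratio\<close>.\<close>

lemma joint_density_target_eq:
  assumes "x \<in> space C" "a \<in> space A"
  shows "joint_density B \<pi>t (x, a, e, y) = \<pi>t x a / \<pi>b x a * joint_density B \<pi>b (x, a, e, y)"
  unfolding joint_density_def prod.case
  by (subst target_density_eq[OF assms]) (simp only: mult_ac)

text \<open>Multiplying the behaviour factorization by the policy ratio turns \<open>\<pi>b\<close>
  into \<open>\<pi>t\<close> and leaves \<open>q\<close> untouched. Sharing \<open>q\<close> is what
  allows both policies to use the same conditional expectation of the outcome.\<close>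

lemma factorized_target: "AE (x, a, e, y) in joint_ref B. joint_density B \<pi>t (x, a, e, y) =
      p_ctx B x * \<pi>t x a * p_emb B (x, a) e * q (x, e) y"
  using factorized AE_space
proof eventually_elim
  case (elim z)
  obtain x a e y where z: "z = (x, a, e, y)" by (cases z)
  have sp: "x \<in> space C" "a \<in> space A"
    using elim(2) by (auto simp: z joint_ref_def space_pair_measure)
  have "joint_density B \<pi>t (x, a, e, y) =
      \<pi>t x a / \<pi>b x a * (p_ctx B x * \<pi>b x a * p_emb B (x, a) e * q (x, e) y)"
    unfolding joint_density_target_eq[OF sp] using elim(1) by (simp add: z)
  also have "\<dots> = p_ctx B x * (\<pi>t x a / \<pi>b x a * \<pi>b x a) * p_emb B (x, a) e * q (x, e) y"
    by simp
  finally show ?case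
    unfolding target_density_eq[OF sp, symmetric] by (simp add: z)
qed

text \<open>The two joint densities differ pointwise by the policy ratio, so \<open>f\<close> may
  depend on all four variables.\<close>

lemma nn_integral_target_eq_rho:
  assumes [measurable]: "f \<in> borel_measurable (C \<Otimes>\<^sub>M A \<Otimes>\<^sub>M E \<Otimes>\<^sub>M Y)"
  shows "(\<integral>\<^sup>+z. f z \<partial>joint_law B \<pi>t) =
    (\<integral>\<^sup>+z. f z * (case z of (x, a, e, y) \<Rightarrow> ennreal (\<pi>t x a / \<pi>b x a)) \<partial>joint_law B \<pi>b)"
proof -
  have "f z * ennreal (joint_density B \<pi>t z) =
      f z * (case z of (x, a, e, y) \<Rightarrow> ennreal (\<pi>t x a / \<pi>b x a)) * ennreal (joint_density B \<pi>b z)"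
    if "z \<in> space (C \<Otimes>\<^sub>M A \<Otimes>\<^sub>M E \<Otimes>\<^sub>M Y)" for z
  proof -
    obtain x a e y where z: "z = (x, a, e, y)" by (cases z)
    have sp: "x \<in> space C" "a \<in> space A" using that by (auto simp: z space_pair_measure)
    have "0 \<le> \<pi>t x a / \<pi>b x a"
      using sp policy_nonneg[OF target] policy_nonneg[OF behaviour] by simp
    then show ?thesis
      by (simp only: z prod.case joint_density_target_eq[OF sp] ennreal_mult' mult.assoc)
  qed
  then show ?thesis
    by (simp add: nn_integral_joint_law[OF behaviour] nn_integral_joint_law[OF target]
        cong: nn_integral_cong)
qed

section \<open>Conditional expectation given context and embedding\<close>

definition cond_out :: "('x \<Rightarrow> 'e \<Rightarrow> real \<Rightarrow> ennreal) \<Rightarrow> 'x \<Rightarrow> 'e \<Rightarrow> ennreal" where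
  "cond_out g x e = (\<integral>\<^sup>+y. g x e y * ennreal (q (x, e) y) \<partial>Y)"

lemma cond_out_measurable [measurable (raw)]:
  assumes "(\<lambda>(x, e, y). g x e y) \<in> borel_measurable (C \<Otimes>\<^sub>M E \<Otimes>\<^sub>M Y)"
    and [measurable]: "f \<in> measurable N C" "h \<in> measurable N E"
  shows "(\<lambda>z. cond_out g (f z) (h z)) \<in> borel_measurable N"
proof -
  note [measurable (raw)] = measurable_uncurry3[OF assms(1)]
  show ?thesis unfolding cond_out_def by measurable
qed

text \<open>The tower property. In the factorized density the outcome enters only through
  \<open>q (x, e)\<close>, so the integral over y yields \<open>cond_out g x e\<close>, with no
  trace of the action or the policy. The remaining factors form the density of (X, A, E), by
  \<open>nn_integral_joint_law_XAE\<close>.\<close>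

lemma nn_integral_cond_out:
  assumes \<pi>: "policy B \<pi>"
    and fac: "AE (x, a, e, y) in joint_ref B. joint_density B \<pi> (x, a, e, y) =
      p_ctx B x * \<pi> x a * p_emb B (x, a) e * q (x, e) y"
    and g: "(\<lambda>(x, e, y). g x e y) \<in> borel_measurable (C \<Otimes>\<^sub>M E \<Otimes>\<^sub>M Y)"
  shows "(\<integral>\<^sup>+(x, a, e, y). g x e y \<partial>joint_law B \<pi>) = (\<integral>\<^sup>+(x, a, e, y). cond_out g x e \<partial>joint_law B \<pi>)"
proof -
  note [measurable (raw)] = policy_measurable[OF \<pi>]
  note [measurable] = joint_density_measurable[OF \<pi>]
  note [measurable (raw)] = measurable_uncurry3[OF g]
  have "(\<integral>\<^sup>+(x, a, e, y). g x e y \<partial>joint_law B \<pi>) = (\<integral>\<^sup>+z. (case z of (x, a, e, y) \<Rightarrow>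
      g x e y * ennreal (p_ctx B x * \<pi> x a * p_emb B (x, a) e * q (x, e) y)) \<partial>(C \<Otimes>\<^sub>M A \<Otimes>\<^sub>M E \<Otimes>\<^sub>M Y))"
    using fac unfolding joint_ref_def
    by (subst nn_integral_joint_law[OF \<pi>]) (auto intro!: nn_integral_cong_AE)
  also have "\<dots> = (\<integral>\<^sup>+x. \<integral>\<^sup>+a. \<integral>\<^sup>+e. \<integral>\<^sup>+y.
      g x e y * ennreal (p_ctx B x * \<pi> x a * p_emb B (x, a) e * q (x, e) y) \<partial>Y \<partial>E \<partial>A \<partial>C)"
    by (subst nn_integral_pair4[OF sigma_finite(2-4)]) auto
  also have "\<dots> = (\<integral>\<^sup>+x. \<integral>\<^sup>+a. \<integral>\<^sup>+e.
      cond_out g x e * ennreal (p_ctx B x * \<pi> x a * p_emb B (x, a) e) \<partial>E \<partial>A \<partial>C)"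
  proof (intro nn_integral_cong)
    fix x a e assume sp: "x \<in> space C" "a \<in> space A" "e \<in> space E"
    let ?c = "p_ctx B x * \<pi> x a * p_emb B (x, a) e"
    have c: "0 \<le> ?c"
      using sp ctx_nonneg policy_nonneg[OF \<pi>] cond_density_nonneg[OF emb]
      by (auto simp: space_pair_measure)
    have "(\<integral>\<^sup>+y. g x e y * ennreal (?c * q (x, e) y) \<partial>Y) =
        (\<integral>\<^sup>+y. ennreal ?c * (g x e y * ennreal (q (x, e) y)) \<partial>Y)"
      by (simp only: ennreal_mult'[OF c]) (simp only: mult_ac)
    also have "\<dots> = cond_out g x e * ennreal ?c"
      unfolding cond_out_def using sp by (subst nn_integral_cmult) (auto simp: mult.commute)
    finally show "(\<integral>\<^sup>+y. g x e y * ennreal (?c * q (x, e) y) \<partial>Y) = cond_out g x e * ennreal ?c" .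
  qed
  also have "\<dots> = (\<integral>\<^sup>+(x, a, e, y). cond_out g x e \<partial>joint_law B \<pi>)"
    by (subst nn_integral_joint_law_XAE[OF \<pi>]) auto
  finally show ?thesis .
qed

section \<open>Marginal densities and their ratios\<close>

lemma density_EX_measurable:
  assumes "policy B \<pi>" and [measurable]: "f \<in> measurable N E" "g \<in> measurable N C"
  shows "(\<lambda>z. density_EX B \<pi> (f z) (g z)) \<in> borel_measurable N"
proof -
  note [measurable] = joint_density_measurable[OF assms(1)]
  show ?thesis unfolding density_EX_def by measurable
qed

lemma density_Y_measurable:
  assumes "policy B \<pi>" and [measurable]: "f \<in> measurable N Y"
  shows "(\<lambda>z. density_Y B \<pi> (f z)) \<in> borel_measurable N"
proof -
  note [measurable] = joint_density_measurable[OF assms(1)]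
  show ?thesis unfolding density_Y_def by measurable
qed

lemma density_EX_nonneg:
  assumes "policy B \<pi>" "x \<in> space C" "e \<in> space E"
  shows "0 \<le> density_EX B \<pi> e x"
  unfolding density_EX_def using assms
  by (intro Bochner_Integration.integral_nonneg)
    (auto simp: space_pair_measure joint_density_nonneg)

lemma density_Y_nonneg:
  assumes "policy B \<pi>" "y \<in> space Y"
  shows "0 \<le> density_Y B \<pi> y"
  unfolding density_Y_def using assms
  by (intro Bochner_Integration.integral_nonneg)
    (auto simp: space_pair_measure joint_density_nonneg)

definition wEX :: "'x \<Rightarrow> 'e \<Rightarrow> real" where
  "wEX x e = density_EX B \<pi>t e x / density_EX B \<pi>b e x"

definition wY :: "real \<Rightarrow> real" where
  "wY y = density_Y B \<pi>t y / density_Y B \<pi>b y"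

lemma wEX_measurable [measurable (raw)]:
  "f \<in> measurable N C \<Longrightarrow> g \<in> measurable N E \<Longrightarrow> (\<lambda>z. wEX (f z) (g z)) \<in> borel_measurable N"
  unfolding wEX_def by (intro borel_measurable_divide density_EX_measurable behaviour target)

lemma wY_measurable [measurable (raw)]:
  "f \<in> measurable N Y \<Longrightarrow> (\<lambda>z. wY (f z)) \<in> borel_measurable N"
  unfolding wY_def by (intro borel_measurable_divide density_Y_measurable behaviour target)

lemma wEX_nonneg: "x \<in> space C \<Longrightarrow> e \<in> space E \<Longrightarrow> 0 \<le> wEX x e"
  by (simp add: wEX_def density_EX_nonneg behaviour target)

lemma wY_nonneg: "y \<in> space Y \<Longrightarrow> 0 \<le> wY y"
  by (simp add: wY_def density_Y_nonneg behaviour target)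

section \<open>Reweighting by ratios of marginal densities\<close>

lemma nn_integral_target_eq_wEX_XE:
  assumes g: "(\<lambda>(x, e). g x e) \<in> borel_measurable (C \<Otimes>\<^sub>M E)"
  shows "(\<integral>\<^sup>+(x, a, e, y). g x e \<partial>joint_law B \<pi>t) =
    (\<integral>\<^sup>+(x, a, e, y). g x e * ennreal (wEX x e) \<partial>joint_law B \<pi>b)"
proof -
  note [measurable (raw)] = measurable_uncurry2[OF g]
  \<comment> \<open>\<open>F\<close> places (x, e) in the first component, so that its integral over
    the second component is \<open>density_EX\<close> and the ratio in
    \<open>nn_integral_marginal_ratio\<close> becomes \<open>wEX\<close>.\<close>
  define F where "F \<pi> = (\<lambda>((x, e), (a, y)). joint_density B \<pi> (x, a, e, y))" for \<pi>
  let ?K = "(C \<Otimes>\<^sub>M E) \<Otimes>\<^sub>M (A \<Otimes>\<^sub>M Y)"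
  have mF: "F \<pi> \<in> borel_measurable ?K" if "policy B \<pi>" for \<pi>
    using joint_density_measurable[OF that] unfolding F_def split_beta' by measurable
  have F0: "0 \<le> F \<pi> z" if "policy B \<pi>" "z \<in> space ?K" for \<pi> z
    using that by (auto simp: F_def space_pair_measure joint_density_nonneg)
  have reorder: "(\<integral>\<^sup>+(x, a, e, y). h x e \<partial>joint_law B \<pi>) = (\<integral>\<^sup>+z. (case fst z of (x, e) \<Rightarrow> h x e) * ennreal (F \<pi> z) \<partial>?K)"
    if \<pi>: "policy B \<pi>" and h: "(\<lambda>(x, e). h x e) \<in> borel_measurable (C \<Otimes>\<^sub>M E)" for \<pi> h
  proof -
    note [measurable] = joint_density_measurable[OF \<pi>]
    note [measurable (raw)] = measurable_uncurry2[OF h]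
    show ?thesis
      by (subst nn_integral_joint_law[OF \<pi>], simp,
          subst nn_integral_pair4_middle_swap[OF sigma_finite(2-4)])
        (auto simp: F_def split_beta' intro!: nn_integral_cong)
  qed
  have fin: "(\<integral>\<^sup>+z. ennreal (F \<pi> z) \<partial>?K) \<noteq> \<infinity>" if \<pi>: "policy B \<pi>" for \<pi>
    using reorder[OF \<pi>, of "\<lambda>_ _. 1"] by (simp add: split_beta' emeasure_joint_law[OF \<pi>])
  have w: "wEX x e = (\<integral>z. F \<pi>t ((x, e), z) \<partial>(A \<Otimes>\<^sub>M Y)) / (\<integral>z. F \<pi>b ((x, e), z) \<partial>(A \<Otimes>\<^sub>M Y))" for x e
    by (simp add: wEX_def density_EX_def F_def)
  have "(\<integral>\<^sup>+z. (case_prod g (fst z)) * ennreal (F \<pi>t z) \<partial>?K) =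
      (\<integral>\<^sup>+z. case_prod g (fst z) * ennreal ((\<integral>y. F \<pi>t (fst z, y) \<partial>(A \<Otimes>\<^sub>M Y)) / (\<integral>y. F \<pi>b (fst z, y) \<partial>(A \<Otimes>\<^sub>M Y)))
         * ennreal (F \<pi>b z) \<partial>?K)"
    by (rule nn_integral_marginal_ratio)
      (use mF F0 fin behaviour target AY.sigma_finite_measure_axioms in
        \<open>auto simp: space_pair_measure F_def joint_density_target_eq\<close>)
  also have "\<dots> = (\<integral>\<^sup>+z. (case fst z of (x, e) \<Rightarrow> g x e * ennreal (wEX x e)) * ennreal (F \<pi>b z) \<partial>?K)"
    by (auto simp: w intro!: nn_integral_cong)
  finally show ?thesis
    by (subst reorder[OF target g], subst reorder[OF behaviour]) auto
qed

text \<open>Conditional independence enters here. Averaging over y under the target policy leaves a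
  function of (x, e), to which the ratio of marginals applies. The weight does not involve y, so it
  can be moved inside the average, and the average can be undone under the behaviour policy because
  both policies share \<open>q\<close>.\<close>

lemma nn_integral_target_eq_wEX:
  assumes g: "(\<lambda>(x, e, y). g x e y) \<in> borel_measurable (C \<Otimes>\<^sub>M E \<Otimes>\<^sub>M Y)"
  shows "(\<integral>\<^sup>+(x, a, e, y). g x e y \<partial>joint_law B \<pi>t) =
    (\<integral>\<^sup>+(x, a, e, y). g x e y * ennreal (wEX x e) \<partial>joint_law B \<pi>b)"
proof -
  note [measurable (raw)] = measurable_uncurry3[OF g]
  have w: "cond_out (\<lambda>x e y. g x e y * ennreal (wEX x e)) x e = cond_out g x e * ennreal (wEX x e)"
    if sp: "x \<in> space C" "e \<in> space E" for x e
  proof -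
    have "cond_out (\<lambda>x e y. g x e y * ennreal (wEX x e)) x e =
        (\<integral>\<^sup>+y. ennreal (wEX x e) * (g x e y * ennreal (q (x, e) y)) \<partial>Y)"
      unfolding cond_out_def by (simp only: mult_ac)
    also have "\<dots> = ennreal (wEX x e) * cond_out g x e"
      unfolding cond_out_def using sp by (intro nn_integral_cmult) auto
    finally show ?thesis by (simp add: mult.commute)
  qed
  have "(\<integral>\<^sup>+(x, a, e, y). g x e y \<partial>joint_law B \<pi>t) = (\<integral>\<^sup>+(x, a, e, y). cond_out g x e \<partial>joint_law B \<pi>t)"
    by (rule nn_integral_cond_out[OF target factorized_target g])
  also have "\<dots> = (\<integral>\<^sup>+(x, a, e, y). cond_out g x e * ennreal (wEX x e) \<partial>joint_law B \<pi>b)"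
    by (rule nn_integral_target_eq_wEX_XE) simp
  also have "\<dots> = (\<integral>\<^sup>+(x, a, e, y). cond_out (\<lambda>x e y. g x e y * ennreal (wEX x e)) x e \<partial>joint_law B \<pi>b)"
    by (intro nn_integral_cong) (auto simp: space_joint_law w)
  also have "\<dots> = (\<integral>\<^sup>+(x, a, e, y). g x e y * ennreal (wEX x e) \<partial>joint_law B \<pi>b)"
    by (rule nn_integral_cond_out[OF behaviour factorized, symmetric]) measurable
  finally show ?thesis .
qed

text \<open>As \<open>g\<close> depends on y alone, putting y in the first component makes this a
  direct instance of \<open>nn_integral_marginal_ratio\<close>.\<close>

lemma nn_integral_target_eq_wY:
  assumes g [measurable]: "g \<in> borel_measurable Y"
  shows "(\<integral>\<^sup>+(x, a, e, y). g y \<partial>joint_law B \<pi>t) =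
    (\<integral>\<^sup>+(x, a, e, y). g y * ennreal (wY y) \<partial>joint_law B \<pi>b)"
proof -
  define F where "F \<pi> = (\<lambda>(y, (x, a, e)). joint_density B \<pi> (x, a, e, y))" for \<pi>
  let ?K = "Y \<Otimes>\<^sub>M (C \<Otimes>\<^sub>M A \<Otimes>\<^sub>M E)"
  have mF: "F \<pi> \<in> borel_measurable ?K" if "policy B \<pi>" for \<pi>
    using joint_density_measurable[OF that] unfolding F_def split_beta' by measurable
  have F0: "0 \<le> F \<pi> z" if "policy B \<pi>" "z \<in> space ?K" for \<pi> z
    using that by (auto simp: F_def space_pair_measure joint_density_nonneg)
  have reorder: "(\<integral>\<^sup>+(x, a, e, y). h y \<partial>joint_law B \<pi>) = (\<integral>\<^sup>+z. h (fst z) * ennreal (F \<pi> z) \<partial>?K)"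
    if \<pi>: "policy B \<pi>" and h [measurable]: "h \<in> borel_measurable Y" for \<pi> h
  proof -
    note [measurable] = joint_density_measurable[OF \<pi>]
    show ?thesis
      by (subst nn_integral_joint_law[OF \<pi>], simp,
          subst nn_integral_pair4_rotate[OF sigma_finite])
        (auto simp: F_def split_beta' intro!: nn_integral_cong)
  qed
  have fin: "(\<integral>\<^sup>+z. ennreal (F \<pi> z) \<partial>?K) \<noteq> \<infinity>" if \<pi>: "policy B \<pi>" for \<pi>
    using reorder[OF \<pi>, of "\<lambda>_. 1"] by (simp add: split_beta' emeasure_joint_law[OF \<pi>])
  have w: "wY y = (\<integral>z. F \<pi>t (y, z) \<partial>(C \<Otimes>\<^sub>M A \<Otimes>\<^sub>M E)) / (\<integral>z. F \<pi>b (y, z) \<partial>(C \<Otimes>\<^sub>M A \<Otimes>\<^sub>M E))" for y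
    by (simp add: wY_def density_Y_def F_def)
  have "(\<integral>\<^sup>+z. g (fst z) * ennreal (F \<pi>t z) \<partial>?K) =
      (\<integral>\<^sup>+z. g (fst z) * ennreal ((\<integral>x. F \<pi>t (fst z, x) \<partial>(C \<Otimes>\<^sub>M A \<Otimes>\<^sub>M E)) / (\<integral>x. F \<pi>b (fst z, x) \<partial>(C \<Otimes>\<^sub>M A \<Otimes>\<^sub>M E)))
         * ennreal (F \<pi>b z) \<partial>?K)"
    by (rule nn_integral_marginal_ratio)
      (use mF F0 fin behaviour target CAE.sigma_finite_measure_axioms in
        \<open>auto simp: space_pair_measure F_def joint_density_target_eq\<close>)
  also have "\<dots> = (\<integral>\<^sup>+z. (g (fst z) * ennreal (wY (fst z))) * ennreal (F \<pi>b z) \<partial>?K)"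
    by (simp add: w)
  finally show ?thesis
    by (subst reorder[OF target g], subst reorder[OF behaviour]) auto
qed

section \<open>The outcome and the three weights as functions of a data point\<close>

definition outcome :: "'x \<times> 'a \<times> 'e \<times> real \<Rightarrow> real" where
  "outcome = (\<lambda>(x, a, e, y). y)"

definition ipw_weight :: "'x \<times> 'a \<times> 'e \<times> real \<Rightarrow> real" where
  "ipw_weight = (\<lambda>(x, a, e, y). \<pi>t x a / \<pi>b x a)"

definition mips_weight :: "'x \<times> 'a \<times> 'e \<times> real \<Rightarrow> real" where
  "mips_weight = (\<lambda>(x, a, e, y). wEX x e)"

definition mr_weight :: "'x \<times> 'a \<times> 'e \<times> real \<Rightarrow> real" where
  "mr_weight = (\<lambda>(x, a, e, y). wY y)"

lemma weights_measurable [measurable]: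
  "outcome \<in> borel_measurable (C \<Otimes>\<^sub>M A \<Otimes>\<^sub>M E \<Otimes>\<^sub>M Y)"
  "ipw_weight \<in> borel_measurable (C \<Otimes>\<^sub>M A \<Otimes>\<^sub>M E \<Otimes>\<^sub>M Y)"
  "mips_weight \<in> borel_measurable (C \<Otimes>\<^sub>M A \<Otimes>\<^sub>M E \<Otimes>\<^sub>M Y)"
  "mr_weight \<in> borel_measurable (C \<Otimes>\<^sub>M A \<Otimes>\<^sub>M E \<Otimes>\<^sub>M Y)"
  unfolding outcome_def ipw_weight_def mips_weight_def mr_weight_def split_beta'
  using measurable_compose[OF _ outcome_measurable, of "\<lambda>z. snd (snd (snd z))"]
  by measurable

lemma weights_nonneg:
  assumes "z \<in> space (joint_law B \<pi>b)"
  shows "0 \<le> ipw_weight z" "0 \<le> mips_weight z" "0 \<le> mr_weight z"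
  using assms policy_nonneg[OF target] policy_nonneg[OF behaviour] wEX_nonneg wY_nonneg
  by (auto simp: space_joint_law ipw_weight_def mips_weight_def mr_weight_def)

text \<open>Functions of the outcome alone are admissible for every one of the weights. The three
  identities serve as hypothesis \<open>eq\<close> of \<open>integrable_reweighted\<close> and
  \<open>integral_reweighted\<close>.\<close>

lemma nn_integral_target_eq_weights:
  fixes h :: "real \<Rightarrow> ennreal"
  assumes [measurable]: "h \<in> borel_measurable borel"
  shows "(\<integral>\<^sup>+z. h (outcome z) \<partial>joint_law B \<pi>t) =
      (\<integral>\<^sup>+z. h (outcome z) * ennreal (ipw_weight z) \<partial>joint_law B \<pi>b)"
    and "(\<integral>\<^sup>+z. h (outcome z) \<partial>joint_law B \<pi>t) =
      (\<integral>\<^sup>+z. h (outcome z) * ennreal (mips_weight z) \<partial>joint_law B \<pi>b)"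
    and "(\<integral>\<^sup>+z. h (outcome z) \<partial>joint_law B \<pi>t) =
      (\<integral>\<^sup>+z. h (outcome z) * ennreal (mr_weight z) \<partial>joint_law B \<pi>b)"
proof -
  note [measurable] = measurable_compose[OF outcome_measurable assms]
  show "(\<integral>\<^sup>+z. h (outcome z) \<partial>joint_law B \<pi>t) =
      (\<integral>\<^sup>+z. h (outcome z) * ennreal (ipw_weight z) \<partial>joint_law B \<pi>b)"
    by (subst nn_integral_target_eq_rho) (auto simp: ipw_weight_def split_beta')
  show "(\<integral>\<^sup>+z. h (outcome z) \<partial>joint_law B \<pi>t) =
      (\<integral>\<^sup>+z. h (outcome z) * ennreal (mips_weight z) \<partial>joint_law B \<pi>b)"
    using nn_integral_target_eq_wEX[of "\<lambda>x e y. h y"]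
    by (simp add: mips_weight_def outcome_def split_beta')
  show "(\<integral>\<^sup>+z. h (outcome z) \<partial>joint_law B \<pi>t) =
      (\<integral>\<^sup>+z. h (outcome z) * ennreal (mr_weight z) \<partial>joint_law B \<pi>b)"
    using nn_integral_target_eq_wY[of h]
    by (simp add: mr_weight_def outcome_def split_beta')
qed

text \<open>Integrability of the weighted outcome under the behaviour policy is derived from that of
  the outcome under the target policy; the results on sample means ask for it at a single data
  point.\<close>

lemma
  assumes "integrable (joint_law B \<pi>t) outcome"
    and "v \<in> {ipw_weight, mips_weight, mr_weight}"
  shows integrable_weighted_outcome: "integrable (joint_law B \<pi>b) (\<lambda>z. v z * outcome z)"
    and integral_weighted_outcome:
      "(\<integral>z. v z * outcome z \<partial>joint_law B \<pi>b) = (\<integral>z. outcome z \<partial>joint_law B \<pi>t)"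
proof -
  have v: "v \<in> borel_measurable (joint_law B \<pi>b)" "\<And>z. z \<in> space (joint_law B \<pi>b) \<Longrightarrow> 0 \<le> v z"
    using assms(2) weights_nonneg by auto
  have eq: "(\<integral>\<^sup>+z. h (outcome z) \<partial>joint_law B \<pi>t) = (\<integral>\<^sup>+z. h (outcome z) * ennreal (v z) \<partial>joint_law B \<pi>b)"
    if "h \<in> borel_measurable borel" for h
    using assms(2) nn_integral_target_eq_weights[OF that] by auto
  have o: "outcome \<in> borel_measurable (joint_law B \<pi>b)" and sets: "sets (joint_law B \<pi>t) = sets (joint_law B \<pi>b)"
    by (auto simp: sets_joint_law)
  show "integrable (joint_law B \<pi>b) (\<lambda>z. v z * outcome z)"
    by (rule integrable_reweighted[OF o v(1) sets v(2) eq assms(1)])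
  show "(\<integral>z. v z * outcome z \<partial>joint_law B \<pi>b) = (\<integral>z. outcome z \<partial>joint_law B \<pi>t)"
    by (rule integral_reweighted[OF o v(1) sets v(2) eq assms(1)])
qed

text \<open>The function \<open>wEX x e * y\<^sup>2\<close> depends on (x, e, y) only, so it can be
  reweighted both by the MIPS weight and by the policy ratio; both integrals equal its integral
  under the target policy.\<close>

lemma second_moment_mips_le_ipw:
  assumes "integrable (joint_law B \<pi>b) (\<lambda>z. (ipw_weight z * outcome z)\<^sup>2)"
    and "integrable (joint_law B \<pi>b) (\<lambda>z. (mips_weight z * outcome z)\<^sup>2)"
  shows "(\<integral>z. (mips_weight z * outcome z)\<^sup>2 \<partial>joint_law B \<pi>b) \<le>
    (\<integral>z. (ipw_weight z * outcome z)\<^sup>2 \<partial>joint_law B \<pi>b)"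
proof (rule second_moment_reweighted_le[OF _ _ _ _ _ assms])
  note [measurable (raw)] = measurable_compose[OF _ outcome_measurable]
  let ?g = "\<lambda>z. ennreal (mips_weight z * (outcome z)\<^sup>2)"
  have "(\<integral>\<^sup>+z. ?g z * ennreal (mips_weight z) \<partial>joint_law B \<pi>b) = (\<integral>\<^sup>+z. ?g z \<partial>joint_law B \<pi>t)"
    using nn_integral_target_eq_wEX[of "\<lambda>x e y. ennreal (wEX x e * y\<^sup>2)"]
    by (simp add: mips_weight_def outcome_def split_beta')
  also have "\<dots> = (\<integral>\<^sup>+z. ?g z * ennreal (ipw_weight z) \<partial>joint_law B \<pi>b)"
    by (subst nn_integral_target_eq_rho) (auto simp: ipw_weight_def split_beta')
  finally show "(\<integral>\<^sup>+z. ?g z * ennreal (mips_weight z) \<partial>joint_law B \<pi>b) =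
      (\<integral>\<^sup>+z. ?g z * ennreal (ipw_weight z) \<partial>joint_law B \<pi>b)" .
qed (auto simp: weights_nonneg)

text \<open>The test function is now \<open>wY y * y\<^sup>2\<close>: it depends on y alone, hence
  is admissible for the MR weight, and as a function of (x, e, y) also for the MIPS weight.\<close>

lemma second_moment_mr_le_mips:
  assumes "integrable (joint_law B \<pi>b) (\<lambda>z. (mips_weight z * outcome z)\<^sup>2)"
    and "integrable (joint_law B \<pi>b) (\<lambda>z. (mr_weight z * outcome z)\<^sup>2)"
  shows "(\<integral>z. (mr_weight z * outcome z)\<^sup>2 \<partial>joint_law B \<pi>b) \<le>
    (\<integral>z. (mips_weight z * outcome z)\<^sup>2 \<partial>joint_law B \<pi>b)"
proof (rule second_moment_reweighted_le[OF _ _ _ _ _ assms])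
  note [measurable (raw)] = measurable_compose[OF _ outcome_measurable]
  let ?g = "\<lambda>z. ennreal (mr_weight z * (outcome z)\<^sup>2)"
  have "(\<integral>\<^sup>+z. ?g z * ennreal (mr_weight z) \<partial>joint_law B \<pi>b) = (\<integral>\<^sup>+z. ?g z \<partial>joint_law B \<pi>t)"
    using nn_integral_target_eq_wY[of "\<lambda>y. ennreal (wY y * y\<^sup>2)"]
    by (simp add: mr_weight_def outcome_def split_beta')
  also have "\<dots> = (\<integral>\<^sup>+z. ?g z * ennreal (mips_weight z) \<partial>joint_law B \<pi>b)"
    using nn_integral_target_eq_wEX[of "\<lambda>x e y. ennreal (wY y * y\<^sup>2)"]
    by (simp add: mips_weight_def mr_weight_def outcome_def split_beta')
  finally show "(\<integral>\<^sup>+z. ?g z * ennreal (mr_weight z) \<partial>joint_law B \<pi>b) =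
      (\<integral>\<^sup>+z. ?g z * ennreal (mips_weight z) \<partial>joint_law B \<pi>b)" .
qed (auto simp: weights_nonneg)

end

section \<open>Means and variances of the three estimators\<close>

theorem theorem3p6:
  fixes B :: "('x, 'a, 'e) bandit"
    and \<pi>b \<pi>t :: "'x \<Rightarrow> 'a \<Rightarrow> real"
    and M :: "'w measure"
    and D :: "nat \<Rightarrow> 'w \<Rightarrow> 'x \<times> 'a \<times> 'e \<times> real"
    and n :: nat
  assumes model: "bandit_model B"
    and behaviour: "policy B \<pi>b"
    and target: "policy B \<pi>t"
    and support: "\<And>x a. x \<in> space (ctx_ref B) \<Longrightarrow> a \<in> space (act_ref B) \<Longrightarrow> \<pi>t x a > 0 \<Longrightarrow> \<pi>b x a > 0"
    and indep_b: "Y_indep_A_given_XE B \<pi>b"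
    and indep_t: "Y_indep_A_given_XE B \<pi>t"
    and prob: "prob_space M"
    and n: "n \<ge> 1"
    and data_indep: "prob_space.indep_vars M (\<lambda>_. joint_ref B) D {1..n}"
    and data_law: "\<And>i. i \<in> {1..n} \<Longrightarrow> distributed M (joint_ref B) (D i) (joint_density B \<pi>b)"
    and Y_finite: "integrable (joint_law B \<pi>t) (\<lambda>(x, a, e, y). y)"
    and IPW_finite: "finite_mean_and_variance M (\<lambda>\<omega>. IPW \<pi>b \<pi>t n (\<lambda>i. D i \<omega>))"
    and MIPS_finite: "finite_mean_and_variance M (\<lambda>\<omega>. MIPS B \<pi>b \<pi>t n (\<lambda>i. D i \<omega>))"
    and MR_finite: "finite_mean_and_variance M (\<lambda>\<omega>. MR B \<pi>b \<pi>t n (\<lambda>i. D i \<omega>))"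
  shows "prob_space.expectation M (\<lambda>\<omega>. MR B \<pi>b \<pi>t n (\<lambda>i. D i \<omega>))
           = prob_space.expectation M (\<lambda>\<omega>. MIPS B \<pi>b \<pi>t n (\<lambda>i. D i \<omega>))
       \<and> prob_space.expectation M (\<lambda>\<omega>. MIPS B \<pi>b \<pi>t n (\<lambda>i. D i \<omega>))
           = prob_space.expectation (joint_law B \<pi>t) (\<lambda>(x, a, e, y). y)
       \<and> prob_space.variance M (\<lambda>\<omega>. MR B \<pi>b \<pi>t n (\<lambda>i. D i \<omega>))
           \<le> prob_space.variance M (\<lambda>\<omega>. MIPS B \<pi>b \<pi>t n (\<lambda>i. D i \<omega>))
       \<and> prob_space.variance M (\<lambda>\<omega>. MIPS B \<pi>b \<pi>t n (\<lambda>i. D i \<omega>))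
           \<le> prob_space.variance M (\<lambda>\<omega>. IPW \<pi>b \<pi>t n (\<lambda>i. D i \<omega>))"
proof -
  obtain q where "cond_density (ctx_ref B \<Otimes>\<^sub>M emb_ref B) (out_ref B) q"
    "AE (x, a, e, y) in joint_ref B. joint_density B \<pi>b (x, a, e, y) =
      p_ctx B x * \<pi>b x a * p_emb B (x, a) e * q (x, e) y"
    using indep_b unfolding Y_indep_A_given_XE_def by blast
  then interpret bandit_policies B \<pi>b \<pi>t q
    using model behaviour target support by unfold_locales auto
  interpret prob_space M by (rule prob)
  have Y_int: "integrable (joint_law B \<pi>t) outcome"
    using Y_finite unfolding outcome_def .
  have law: "distr M (joint_ref B) (D i) = joint_law B \<pi>b" if "i \<in> {1..n}" for i
    using data_law[OF that] by (simp add: distributed_def joint_law_def)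
  \<comment> \<open>All three estimators take the form of a sample mean of weight times outcome, so
    one computation of mean and variance covers them.\<close>
  have estimators:
    "IPW \<pi>b \<pi>t n = (\<lambda>d. (1 / real n) * (\<Sum>i = 1..n. ipw_weight (d i) * outcome (d i)))"
    "MIPS B \<pi>b \<pi>t n = (\<lambda>d. (1 / real n) * (\<Sum>i = 1..n. mips_weight (d i) * outcome (d i)))"
    "MR B \<pi>b \<pi>t n = (\<lambda>d. (1 / real n) * (\<Sum>i = 1..n. mr_weight (d i) * outcome (d i)))"
    by (simp_all add: fun_eq_iff IPW_def MIPS_def MR_def ipw_weight_def mips_weight_def
        mr_weight_def outcome_def wEX_def wY_def split_beta')
  let ?S = "\<lambda>v \<omega>. (1 / real n) * (\<Sum>i = 1..n. v (D i \<omega>) * outcome (D i \<omega>))"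
  let ?P = "joint_law B \<pi>b"
  let ?m = "\<integral>z. outcome z \<partial>joint_law B \<pi>t"
  let ?W = "{ipw_weight, mips_weight, mr_weight}"
  have meas: "(\<lambda>z. v z * outcome z) \<in> borel_measurable (joint_ref B)" if "v \<in> ?W" for v
    using that by (auto simp: joint_ref_def)
  note mean = integrable_weighted_outcome[OF Y_int] integral_weighted_outcome[OF Y_int]
  note sample = n data_indep law meas mean(1)
  have E: "expectation (?S v) = ?m" if "v \<in> ?W" for v
    using expectation_sample_mean[OF sample] that by (simp only: mean(2)[OF that])
  have fin: "integrable M (\<lambda>\<omega>. (?S v \<omega> - expectation (?S v))\<^sup>2)" if "v \<in> ?W" for v
    using that IPW_finite MIPS_finite MR_finite
    unfolding finite_mean_and_variance_def estimators by blast
  \<comment> \<open>The finite variance of the whole sample mean yields a finite second moment of a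
    single term, which the comparison of second moments requires.\<close>
  have sq: "integrable ?P (\<lambda>z. (v z * outcome z)\<^sup>2)" if "v \<in> ?W" for v
    using square_integrable_sample_mean[OF sample] fin that by blast
  \<comment> \<open>The subtracted mean \<open>?m\<close> is the same for every weight, so comparing
    variances reduces to comparing second moments.\<close>
  have V: "variance (?S v) = ((\<integral>z. (v z * outcome z)\<^sup>2 \<partial>?P) - ?m\<^sup>2) / real n" if "v \<in> ?W" for v
  proof -
    have "variance (?S v) =
        ((\<integral>z. (v z * outcome z)\<^sup>2 \<partial>?P) - (\<integral>z. v z * outcome z \<partial>?P)\<^sup>2) / real n"
      by (rule variance_sample_mean[OF sample]) (assumption | rule that fin)+
    then show ?thesis by (simp only: mean(2)[OF that])
  qed
  have W: "ipw_weight \<in> ?W" "mips_weight \<in> ?W" "mr_weight \<in> ?W" by auto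
  have "variance (?S mr_weight) \<le> variance (?S mips_weight)"
    unfolding V[OF W(2)] V[OF W(3)]
    using second_moment_mr_le_mips[OF sq[OF W(2)] sq[OF W(3)]] by (simp add: divide_right_mono)
  moreover have "variance (?S mips_weight) \<le> variance (?S ipw_weight)"
    unfolding V[OF W(1)] V[OF W(2)]
    using second_moment_mips_le_ipw[OF sq[OF W(1)] sq[OF W(2)]] by (simp add: divide_right_mono)
  moreover have "?m = (\<integral>(x, a, e, y). y \<partial>joint_law B \<pi>t)"
    by (simp add: outcome_def)
  ultimately show ?thesis
    unfolding estimators using E[OF W(2)] E[OF W(3)] by simp
qed

end
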